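(* Let $\mathcal{Q}$ be a quotient module of $H^2(\mathbb{D}^n)$. Then $\mathcal{Q}$ is doubly commuting if and only if there exist quotient modules $\mathcal{Q}_1,\dots,\mathcal{Q}_n$ of $H^2(\mathbb{D})$ such that $$\mathcal{Q}=\mathcal{Q}_1\otimes\cdots\otimes\mathcal{Q}_n.$$
   Context: $H^2(\mathbb{D}^n)$ is the Hardy space over the polydisc, identified with the Hilbert space tensor product $H^2(\mathbb{D})\otimes\cdots\otimes H^2(\mathbb{D})$, with coordinate multiplication operators $M_{z_1},\dots,M_{z_n}$. A quotient module $\mathcal{Q}$ of $H^2(\mathbb{D}^n)$ is a closed subspace invariant under $M_{z_1}^*,\dots,M_{z_n}^*$ (equivalently, the orthogonal complement of a submodule), equipped with $C_{z_i}=P_{\mathcal{Q}}M_{z_i}|_{\mathcal{Q}}$. It is doubly commuting if $C_{z_i}C_{z_j}^*=C_{z_j}^*C_{z_i}$ for all $1\le i<j\le n$. *)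

theory Defs
  imports "HOL-Analysis.Analysis" "HOL-Library.Function_Algebras"
begin

text \<open>
  The polydisc in dimension n is a subset of \<open>complex ^ 'n\<close>, where the finite type \<open>'n\<close> has n
  elements; the disc is the case \<open>complex ^ 1\<close>. Functions on the polydisc are represented by
  total functions that vanish outside of it, so that equality of functions on the polydisc
  is equality in HOL.
\<close>

definition polydisc :: "(complex ^ 'n) set" where
  "polydisc = {z. \<forall>i. norm (z $ i) < 1}"

definition has_taylor :: "(complex ^ 'n \<Rightarrow> complex) \<Rightarrow> (('n \<Rightarrow> nat) \<Rightarrow> complex) \<Rightarrow> bool" where
  "has_taylor f a \<longleftrightarrow>
     (\<forall>z\<in>polydisc. ((\<lambda>k. a k * (\<Prod>i\<in>UNIV. (z $ i) ^ k i)) has_sum f z) UNIV)"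

text \<open>The coefficients of a power series converging on the polydisc are uniquely determined.\<close>

definition taylor :: "(complex ^ 'n \<Rightarrow> complex) \<Rightarrow> ('n \<Rightarrow> nat) \<Rightarrow> complex" where
  "taylor f = (THE a. has_taylor f a)"

definition hardy :: "(complex ^ 'n \<Rightarrow> complex) set" where
  "hardy = {f. (\<forall>z. z \<notin> polydisc \<longrightarrow> f z = 0) \<and>
               (\<exists>a. has_taylor f a \<and> (\<lambda>k. (norm (a k))\<^sup>2) summable_on UNIV)}"

definition hardy_inner :: "(complex ^ 'n \<Rightarrow> complex) \<Rightarrow> (complex ^ 'n \<Rightarrow> complex) \<Rightarrow> complex" where
  "hardy_inner f g = (\<Sum>\<^sub>\<infinity>k. taylor f k * cnj (taylor g k))"

definition hardy_norm :: "(complex ^ 'n \<Rightarrow> complex) \<Rightarrow> real" where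
  "hardy_norm f = sqrt (Re (hardy_inner f f))"

definition hardy_topology :: "(complex ^ 'n \<Rightarrow> complex) topology" where
  "hardy_topology = Metric_space.mtopology hardy (\<lambda>f g. hardy_norm (f - g))"

definition cscale :: "complex \<Rightarrow> ('a \<Rightarrow> complex) \<Rightarrow> 'a \<Rightarrow> complex" where
  "cscale c f = (\<lambda>x. c * f x)"

global_interpretation cfun: vector_space cscale
  by unfold_locales (auto simp: cscale_def fun_eq_iff algebra_simps)

definition mult_coord :: "'n \<Rightarrow> (complex ^ 'n \<Rightarrow> complex) \<Rightarrow> complex ^ 'n \<Rightarrow> complex" where
  "mult_coord i f = (\<lambda>z. z $ i * f z)"

text \<open>
  The next two definitions are meaningful when \<open>S\<close> is a closed subspace of \<open>hardy\<close>:
  the orthogonal projection onto \<open>S\<close>, and the adjoint (with values in \<open>S\<close>) of a bounded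
  operator \<open>T\<close> on the Hilbert space \<open>S\<close>.
\<close>

definition proj_on :: "(complex ^ 'n \<Rightarrow> complex) set \<Rightarrow>
    (complex ^ 'n \<Rightarrow> complex) \<Rightarrow> complex ^ 'n \<Rightarrow> complex" where
  "proj_on S f = (THE g. g \<in> S \<and> (\<forall>h\<in>S. hardy_inner (f - g) h = 0))"

definition adjoint_on :: "(complex ^ 'n \<Rightarrow> complex) set \<Rightarrow>
    ((complex ^ 'n \<Rightarrow> complex) \<Rightarrow> complex ^ 'n \<Rightarrow> complex) \<Rightarrow>
    (complex ^ 'n \<Rightarrow> complex) \<Rightarrow> complex ^ 'n \<Rightarrow> complex" where
  "adjoint_on S T g = (THE h. h \<in> S \<and> (\<forall>f\<in>S. hardy_inner (T f) g = hardy_inner f h))"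

definition quotient_module :: "(complex ^ 'n \<Rightarrow> complex) set \<Rightarrow> bool" where
  "quotient_module Q \<longleftrightarrow>
     Q \<subseteq> hardy \<and> cfun.subspace Q \<and> closedin hardy_topology Q \<and>
     (\<forall>i. \<forall>f\<in>Q. adjoint_on hardy (mult_coord i) f \<in> Q)"

definition compression :: "(complex ^ 'n \<Rightarrow> complex) set \<Rightarrow> 'n \<Rightarrow>
    (complex ^ 'n \<Rightarrow> complex) \<Rightarrow> complex ^ 'n \<Rightarrow> complex" where
  "compression Q i f = proj_on Q (mult_coord i f)"

definition doubly_commuting :: "(complex ^ 'n::{finite,linorder} \<Rightarrow> complex) set \<Rightarrow> bool" where
  "doubly_commuting Q \<longleftrightarrow>
     (\<forall>i j. i < j \<longrightarrow>
        (\<forall>f\<in>Q. compression Q i (adjoint_on Q (compression Q j) f) =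
               adjoint_on Q (compression Q j) (compression Q i f)))"

text \<open>
  Under the identification of the Hardy space over the polydisc with the n-fold Hilbert space
  tensor product of the Hardy space over the disc, an elementary tensor is the function
  \<open>z \<mapsto> f\<^sub>1(z\<^sub>1) \<cdots> f\<^sub>n(z\<^sub>n)\<close>. Here \<open>vec (z $ i)\<close> is the number \<open>z $ i\<close> regarded as an element
  of \<open>complex ^ 1\<close>.
\<close>

definition elem_tensor :: "('n \<Rightarrow> complex ^ 1 \<Rightarrow> complex) \<Rightarrow> complex ^ 'n \<Rightarrow> complex" where
  "elem_tensor f = (\<lambda>z. \<Prod>i\<in>UNIV. f i (vec (z $ i)))"

definition hilbert_tensor ::
    "('n \<Rightarrow> (complex ^ 1 \<Rightarrow> complex) set) \<Rightarrow> (complex ^ 'n \<Rightarrow> complex) set" where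
  "hilbert_tensor R =
     hardy_topology closure_of cfun.span {elem_tensor f | f. \<forall>i. f i \<in> R i}"

end

theory Submission
  imports Defs
begin

text \<open>
  Taylor coefficients identify the Hardy space with \<open>\<ell>\<^sup>2(\<nat>\<^sup>n)\<close>; let \<open>P\<close> be the projection onto the
  quotient module \<open>Q\<close>. If \<open>Q\<close> is a tensor product, \<open>P\<close> acts factorwise on elementary tensors, so
  the double commutation is checked there and extends by linearity and continuity.

  Conversely, let \<open>Q\<close> be doubly commuting, \<open>D\<^sub>i = 1 - C\<^sub>i C\<^sub>i\<^sup>*\<close> and \<open>\<phi> = P 1\<close>. The \<open>D\<^sub>i\<close> commute and
  their product is the rank one operator \<open>f \<mapsto> \<langle>f, \<phi>\<rangle> \<phi>\<close>, so \<open>\<phi>\<close> is an eigenvector of every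
  partial product. Hence \<open>\<parallel>\<phi>\<parallel>\<^sup>2 \<langle>X \<phi>, Y \<phi>\<rangle> = \<langle>X \<phi>, \<phi>\<rangle> \<langle>\<phi>, Y \<phi>\<rangle>\<close> when \<open>X\<close> is a word in \<open>C\<^sub>i, C\<^sub>i\<^sup>*\<close>
  and \<open>Y\<close> a word in the remaining variables. As \<open>P z\<^sup>k = C\<^sup>k \<phi>\<close>, the matrix of \<open>P\<close> is, up to a scalar,
  a product of matrices in one variable each. The i-th tensor factor consists of those \<open>f\<close> whose
  tensor product with the restrictions of \<open>\<phi>\<close> to the other coordinate axes lies in \<open>Q\<close>.
\<close>

section \<open>Square-summable families\<close>

definition square_summable :: "('a \<Rightarrow> complex) \<Rightarrow> bool" where
  "square_summable f \<longleftrightarrow> (\<lambda>k. (norm (f k))\<^sup>2) summable_on UNIV"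

lemma square_summable_mult:
  assumes "square_summable f" "square_summable g"
  shows "(\<lambda>k. norm (f k * g k)) summable_on UNIV"
  using abs_summable_product[of f UNIV g] assms
  by (simp add: square_summable_def norm_mult power2_eq_square)

lemma square_summable_add:
  assumes "square_summable f" "square_summable g"
  shows "square_summable (\<lambda>k. f k + g k)"
  unfolding square_summable_def
proof (rule summable_on_comparison_test)
  show "(\<lambda>k. 2 * (norm (f k))\<^sup>2 + 2 * (norm (g k))\<^sup>2) summable_on UNIV"
    using assms by (intro summable_on_add summable_on_cmult_right) (auto simp: square_summable_def)
  fix k
  have "(norm (f k + g k))\<^sup>2 \<le> (norm (f k) + norm (g k))\<^sup>2"
    by (intro power_mono norm_triangle_ineq) auto
  also have "\<dots> \<le> 2 * (norm (f k))\<^sup>2 + 2 * (norm (g k))\<^sup>2"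
    using zero_le_power2[of "norm (f k) - norm (g k)"] by (simp add: power2_sum power2_diff)
  finally show "(norm (f k + g k))\<^sup>2 \<le> 2 * (norm (f k))\<^sup>2 + 2 * (norm (g k))\<^sup>2" .
qed auto

lemma square_summable_cmult: "square_summable f \<Longrightarrow> square_summable (\<lambda>k. c * f k)"
  unfolding square_summable_def
  by (simp add: norm_mult power_mult_distrib summable_on_cmult_right)

lemma square_summable_uminus: "square_summable f \<Longrightarrow> square_summable (\<lambda>k. - f k)"
  by (simp add: square_summable_def)

lemma square_summable_diff:
  assumes "square_summable f" "square_summable g"
  shows "square_summable (\<lambda>k. f k - g k)"
  using square_summable_add[OF assms(1) square_summable_uminus[OF assms(2)]] by simp

lemma square_summable_cnj: "square_summable f \<Longrightarrow> square_summable (\<lambda>k. cnj (f k))"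
  by (simp add: square_summable_def)

lemma square_summable_zero: "square_summable (\<lambda>k. 0)"
  by (simp add: square_summable_def)

lemma square_summable_inj:
  assumes "square_summable f" "inj h"
  shows "square_summable (\<lambda>k. f (h k))"
proof -
  have "(\<lambda>k. (norm (f k))\<^sup>2) summable_on range h"
    using assms(1) summable_on_subset_banach unfolding square_summable_def by blast
  then show ?thesis
    unfolding square_summable_def using assms(2) by (simp add: summable_on_reindex o_def)
qed

lemma square_summable_le:
  assumes "square_summable f" "\<And>k. norm (g k) \<le> norm (f k)"
  shows "square_summable g"
  using assms(1) unfolding square_summable_def
  by (rule summable_on_comparison_test) (auto intro: power_mono assms(2))

lemma square_summableI_bounded:
  assumes "\<And>F. finite F \<Longrightarrow> (\<Sum>k\<in>F. (norm (f k))\<^sup>2) \<le> B"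
  shows "square_summable f"
  unfolding square_summable_def
  by (rule nonneg_bdd_above_summable_on) (use assms in \<open>auto intro!: bdd_aboveI2\<close>)

section \<open>The Hilbert space of square-summable families\<close>

typedef 'a ell2 = "{f :: 'a \<Rightarrow> complex. square_summable f}" morphisms coef Abs_ell2
  using square_summable_zero by blast

setup_lifting type_definition_ell2

lemma square_summable_coef: "square_summable (coef x)"
  using coef by auto

lemma coef_Abs_ell2: "square_summable f \<Longrightarrow> coef (Abs_ell2 f) = f"
  by (simp add: Abs_ell2_inverse)

lemma ell2_eqI: "(\<And>k. coef x k = coef y k) \<Longrightarrow> x = y"
  by (simp add: coef_inject[symmetric] fun_eq_iff)

lift_definition cscl :: "complex \<Rightarrow> 'a ell2 \<Rightarrow> 'a ell2" (infixr "\<cdot>" 75) is "\<lambda>c f k. c * f k"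
  by (rule square_summable_cmult)

lift_definition cinner :: "'a ell2 \<Rightarrow> 'a ell2 \<Rightarrow> complex" is "\<lambda>f g. \<Sum>\<^sub>\<infinity>k. f k * cnj (g k)" .

instantiation ell2 :: (type) real_vector
begin
lift_definition zero_ell2 :: "'a ell2" is "\<lambda>_. 0" by (rule square_summable_zero)
lift_definition plus_ell2 :: "'a ell2 \<Rightarrow> 'a ell2 \<Rightarrow> 'a ell2" is "\<lambda>f g k. f k + g k"
  by (rule square_summable_add)
lift_definition minus_ell2 :: "'a ell2 \<Rightarrow> 'a ell2 \<Rightarrow> 'a ell2" is "\<lambda>f g k. f k - g k"
  by (rule square_summable_diff)
lift_definition uminus_ell2 :: "'a ell2 \<Rightarrow> 'a ell2" is "\<lambda>f k. - f k"
  by (rule square_summable_uminus)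
definition scaleR_ell2 :: "real \<Rightarrow> 'a ell2 \<Rightarrow> 'a ell2" where "scaleR_ell2 r x = complex_of_real r \<cdot> x"
instance
  by standard (auto simp: scaleR_ell2_def coef_inject[symmetric] fun_eq_iff zero_ell2.rep_eq
      plus_ell2.rep_eq minus_ell2.rep_eq uminus_ell2.rep_eq cscl.rep_eq algebra_simps)
end

lemmas coef_simps [simp] =
  zero_ell2.rep_eq plus_ell2.rep_eq minus_ell2.rep_eq uminus_ell2.rep_eq cscl.rep_eq

lemma summable_cinner: "(\<lambda>k. coef x k * cnj (coef y k)) summable_on UNIV"
  by (rule abs_summable_summable)
     (intro square_summable_mult square_summable_cnj square_summable_coef)

lemma cinner_add_left: "cinner (x + y) z = cinner x z + cinner y z"
  unfolding cinner.rep_eq by (subst infsum_add[symmetric]) (auto simp: summable_cinner algebra_simps)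

lemma cinner_cscl_left [simp]: "cinner (c \<cdot> x) y = c * cinner x y"
  unfolding cinner.rep_eq by (subst infsum_cmult_right'[symmetric]) (simp add: algebra_simps)

lemma cnj_cinner: "cnj (cinner x y) = cinner y x"
  unfolding cinner.rep_eq by (subst infsum_cnj[symmetric]) (simp add: algebra_simps)

lemma cinner_self: "cinner x x = complex_of_real (\<Sum>\<^sub>\<infinity>k. (norm (coef x k))\<^sup>2)"
proof -
  have "((\<lambda>k. (norm (coef x k))\<^sup>2) has_sum (\<Sum>\<^sub>\<infinity>k. (norm (coef x k))\<^sup>2)) UNIV"
    using square_summable_coef[of x] by (simp add: square_summable_def)
  from has_sum_of_real[OF this, where 'a = complex] show ?thesis
    unfolding cinner.rep_eq complex_norm_square by (rule infsumI)
qed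

text \<open>Norm and topology come from the type classes for real inner products, applied to the
  real part of \<open>cinner\<close>; the complex structure is carried alongside by
  \<open>cscl\<close> and \<open>cinner\<close>.\<close>

instantiation ell2 :: (type) real_inner
begin
definition inner_ell2 :: "'a ell2 \<Rightarrow> 'a ell2 \<Rightarrow> real" where "inner_ell2 x y = Re (cinner x y)"
definition norm_ell2 :: "'a ell2 \<Rightarrow> real" where "norm_ell2 x = sqrt (inner x x)"
definition dist_ell2 :: "'a ell2 \<Rightarrow> 'a ell2 \<Rightarrow> real" where "dist_ell2 x y = norm (x - y)"
definition sgn_ell2 :: "'a ell2 \<Rightarrow> 'a ell2" where "sgn_ell2 x = x /\<^sub>R norm x"
definition uniformity_ell2 :: "('a ell2 \<times> 'a ell2) filter"
  where "uniformity_ell2 = (INF e\<in>{0 <..}. principal {(x, y). dist x y < e})"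
definition open_ell2 :: "'a ell2 set \<Rightarrow> bool"
  where "open_ell2 S = (\<forall>x\<in>S. \<forall>\<^sub>F (x', y) in uniformity. x' = x \<longrightarrow> y \<in> S)"
instance
proof
  fix x y z :: "'a ell2" and r :: real
  show "inner x y = inner y x"
    unfolding inner_ell2_def by (subst cnj_cinner[symmetric]) simp
  show "inner (x + y) z = inner x z + inner y z"
    by (simp add: inner_ell2_def cinner_add_left)
  show "inner (r *\<^sub>R x) y = r * inner x y"
    by (simp add: inner_ell2_def scaleR_ell2_def)
  show "0 \<le> inner x x"
    by (simp add: inner_ell2_def cinner_self infsum_nonneg)
  show "inner x x = 0 \<longleftrightarrow> x = 0"
  proof
    assume "inner x x = 0"
    then have *: "(\<Sum>\<^sub>\<infinity>k. (norm (coef x k))\<^sup>2) = 0"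
      by (simp add: inner_ell2_def cinner_self)
    show "x = 0"
    proof (rule ell2_eqI)
      fix k
      have "(\<Sum>k\<in>{k}. (norm (coef x k))\<^sup>2) \<le> (\<Sum>\<^sub>\<infinity>k. (norm (coef x k))\<^sup>2)"
        using square_summable_coef[of x]
        by (intro finite_sum_le_infsum) (auto simp: square_summable_def)
      with * show "coef x k = coef 0 k" by simp
    qed
  qed (simp add: inner_ell2_def cinner_self)
  show "norm x = sqrt (inner x x)" by (simp add: norm_ell2_def)
qed (auto simp: dist_ell2_def sgn_ell2_def uniformity_ell2_def open_ell2_def)
end

lemma cinner_norm: "cinner x x = complex_of_real ((norm x)\<^sup>2)"
  by (simp add: norm_ell2_def inner_ell2_def cinner_self infsum_nonneg)

lemma norm_ell2_sq: "(norm x)\<^sup>2 = (\<Sum>\<^sub>\<infinity>k. (norm (coef x k))\<^sup>2)"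
  using cinner_norm[of x] unfolding cinner_self of_real_eq_iff by simp

lemma sum_coef_le_norm: "finite F \<Longrightarrow> (\<Sum>k\<in>F. (norm (coef x k))\<^sup>2) \<le> (norm x)\<^sup>2"
  unfolding norm_ell2_sq using square_summable_coef[of x]
  by (intro finite_sum_le_infsum) (auto simp: square_summable_def)

lemma norm_ell2_leI:
  assumes "\<And>F. finite F \<Longrightarrow> (\<Sum>k\<in>F. (norm (coef x k))\<^sup>2) \<le> B\<^sup>2" "0 \<le> B"
  shows "norm x \<le> B"
proof -
  have "(norm x)\<^sup>2 \<le> B\<^sup>2"
    unfolding norm_ell2_sq using square_summable_coef[of x] assms(1)
    by (intro infsum_le_finite_sums) (auto simp: square_summable_def)
  then show ?thesis using assms(2) power2_le_imp_le by blast
qed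

lemma norm_coef_le: "norm (coef x k) \<le> norm x"
  using sum_coef_le_norm[of "{k}" x] by simp

text \<open>The coordinates of a Cauchy sequence converge. Bounds on sums over finite index sets
  survive this coordinatewise limit; they first give square-summability of the limit and then
  convergence in norm.\<close>

instance ell2 :: (type) complete_space
proof
  fix X :: "nat \<Rightarrow> 'a ell2"
  assume X: "Cauchy X"
  have "Cauchy (\<lambda>n. coef (X n) k)" for k
    unfolding Cauchy_def
  proof (intro allI impI)
    fix e :: real assume "0 < e"
    with X obtain N where "\<And>m n. m \<ge> N \<Longrightarrow> n \<ge> N \<Longrightarrow> dist (X m) (X n) < e"
      unfolding Cauchy_def by blast
    then show "\<exists>M. \<forall>m\<ge>M. \<forall>n\<ge>M. dist (coef (X m) k) (coef (X n) k) < e"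
      using norm_coef_le[of "X _ - X _" k]
      by (metis dist_norm le_less_trans minus_ell2.rep_eq)
  qed
  then have "\<exists>l. (\<lambda>n. coef (X n) k) \<longlonglongrightarrow> l" for k
    using Cauchy_convergent convergent_def by blast
  then obtain a where a: "\<And>k. (\<lambda>n. coef (X n) k) \<longlonglongrightarrow> a k" by metis
  obtain B where B: "\<And>n. norm (X n) \<le> B"
    using cauchy_imp_bounded[OF X] by (auto simp: bounded_iff)
  have "square_summable a"
  proof (rule square_summableI_bounded)
    fix F :: "'a set" assume F: "finite F"
    show "(\<Sum>k\<in>F. (norm (a k))\<^sup>2) \<le> B\<^sup>2"
    proof (rule LIMSEQ_le_const2)
      show "(\<lambda>n. \<Sum>k\<in>F. (norm (coef (X n) k))\<^sup>2) \<longlonglongrightarrow> (\<Sum>k\<in>F. (norm (a k))\<^sup>2)"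
        by (intro tendsto_intros a)
      show "\<exists>N. \<forall>n\<ge>N. (\<Sum>k\<in>F. (norm (coef (X n) k))\<^sup>2) \<le> B\<^sup>2"
        using sum_coef_le_norm[OF F] B by (meson norm_ge_zero order_trans power_mono)
    qed
  qed
  then have coef_a: "coef (Abs_ell2 a) = a" by (rule coef_Abs_ell2)
  have "X \<longlonglongrightarrow> Abs_ell2 a"
    unfolding LIMSEQ_iff
  proof (intro allI impI)
    fix e :: real assume "0 < e"
    with X obtain N where N: "\<And>m n. m \<ge> N \<Longrightarrow> n \<ge> N \<Longrightarrow> norm (X m - X n) < e / 2"
      unfolding Cauchy_iff by (metis half_gt_zero)
    have "norm (X n - Abs_ell2 a) \<le> e / 2" if "n \<ge> N" for n
    proof (rule norm_ell2_leI)
      fix F :: "'a set" assume F: "finite F"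
      show "(\<Sum>k\<in>F. (norm (coef (X n - Abs_ell2 a) k))\<^sup>2) \<le> (e / 2)\<^sup>2"
      proof (rule LIMSEQ_le_const2)
        show "(\<lambda>m. \<Sum>k\<in>F. (norm (coef (X n - X m) k))\<^sup>2)
            \<longlonglongrightarrow> (\<Sum>k\<in>F. (norm (coef (X n - Abs_ell2 a) k))\<^sup>2)"
          unfolding minus_ell2.rep_eq coef_a by (intro tendsto_intros a)
        show "\<exists>N. \<forall>m\<ge>N. (\<Sum>k\<in>F. (norm (coef (X n - X m) k))\<^sup>2) \<le> (e / 2)\<^sup>2"
          using sum_coef_le_norm[OF F] N[OF that]
          by (meson less_imp_le norm_ge_zero order_trans power_mono)
      qed
    qed (use \<open>0 < e\<close> in simp)
    then show "\<exists>N. \<forall>n\<ge>N. norm (X n - Abs_ell2 a) < e"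
      using \<open>0 < e\<close> by (metis field_sum_of_halves less_add_same_cancel1 half_gt_zero le_less_trans)
  qed
  then show "convergent X" by (auto simp: convergent_def)
qed

global_interpretation ell2: vector_space "cscl :: complex \<Rightarrow> 'a ell2 \<Rightarrow> 'a ell2"
  by unfold_locales (auto intro!: ell2_eqI simp: algebra_simps)

lemma cinner_add_right: "cinner x (y + z) = cinner x y + cinner x z"
  by (metis cinner_add_left cnj_cinner complex_cnj_add)

lemma cinner_cscl_right [simp]: "cinner x (c \<cdot> y) = cnj c * cinner x y"
  by (metis cinner_cscl_left cnj_cinner complex_cnj_mult)

lemma cinner_diff_left: "cinner (x - y) z = cinner x z - cinner y z"
  using cinner_add_left[of "x - y" y z] by simp

lemma cinner_diff_right: "cinner x (y - z) = cinner x y - cinner x z"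
  using cinner_add_right[of x "y - z" z] by simp

lemma cinner_zero [simp]: "cinner 0 x = 0" "cinner x 0 = 0"
  using cinner_diff_left[of x x x] cinner_diff_right[of x x x] by auto

lemma cinner_eq_zero [simp]: "cinner x x = 0 \<longleftrightarrow> x = 0"
  by (simp add: cinner_norm)

text \<open>Upgrades orthogonality: a vector that is real-orthogonal to a set closed under
  multiplication by \<open>\<i>\<close> is complex-orthogonal to it.\<close>

lemma cinner_Complex: "cinner x y = Complex (inner x y) (inner x (\<i> \<cdot> y))"
  by (simp add: inner_ell2_def complex_eq_iff)

lemma norm_cscl [simp]: "norm (c \<cdot> x) = norm c * norm x"
proof -
  have "complex_of_real ((norm (c \<cdot> x))\<^sup>2) = (c * cnj c) * cinner x x"
    unfolding cinner_norm[symmetric] by simp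
  also have "\<dots> = complex_of_real ((norm c * norm x)\<^sup>2)"
    unfolding complex_norm_square[symmetric] cinner_norm by (simp add: power_mult_distrib)
  finally show ?thesis
    unfolding of_real_eq_iff by (simp add: power2_eq_iff_nonneg)
qed

section \<open>Bounded complex linear maps and closed complex subspaces\<close>

definition bounded_clinear :: "('a ell2 \<Rightarrow> 'b ell2) \<Rightarrow> bool" where
  "bounded_clinear f \<longleftrightarrow> bounded_linear f \<and> (\<forall>c x. f (c \<cdot> x) = c \<cdot> f x)"

lemma bounded_clinearI:
  assumes "\<And>x y. f (x + y) = f x + f y" "\<And>c x. f (c \<cdot> x) = c \<cdot> f x" "\<And>x. norm (f x) \<le> norm x * B"
  shows "bounded_clinear f"
  unfolding bounded_clinear_def
  by (intro conjI bounded_linear_intro[where K = B]) (auto simp: assms scaleR_ell2_def)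

lemma bounded_clinear_add: "bounded_clinear f \<Longrightarrow> f (x + y) = f x + f y"
  by (simp add: bounded_clinear_def linear_simps)

lemma bounded_clinear_diff: "bounded_clinear f \<Longrightarrow> f (x - y) = f x - f y"
  by (simp add: bounded_clinear_def linear_simps)

lemma bounded_clinear_zero: "bounded_clinear f \<Longrightarrow> f 0 = 0"
  by (simp add: bounded_clinear_def linear_simps)

lemma bounded_clinear_cscl: "bounded_clinear f \<Longrightarrow> f (c \<cdot> x) = c \<cdot> f x"
  by (simp add: bounded_clinear_def)

lemma bounded_clinear_continuous: "bounded_clinear f \<Longrightarrow> continuous_on S f"
  by (simp add: bounded_clinear_def linear_continuous_on)

lemma bounded_clinear_compose:
  "bounded_clinear f \<Longrightarrow> bounded_clinear g \<Longrightarrow> bounded_clinear (\<lambda>x. f (g x))"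
  by (simp add: bounded_clinear_def bounded_linear_compose)

definition closed_csubspace :: "'a ell2 set \<Rightarrow> bool" where
  "closed_csubspace S \<longleftrightarrow> ell2.subspace S \<and> closed S"

lemma closed_csubspaceD:
  assumes "closed_csubspace S"
  shows "0 \<in> S" "x \<in> S \<Longrightarrow> y \<in> S \<Longrightarrow> x + y \<in> S" "x \<in> S \<Longrightarrow> c \<cdot> x \<in> S"
    "x \<in> S \<Longrightarrow> y \<in> S \<Longrightarrow> x - y \<in> S" "closed S" "ell2.subspace S"
  using assms
  by (auto simp: closed_csubspace_def intro: ell2.subspace_0 ell2.subspace_add ell2.subspace_scale
      ell2.subspace_diff)

lemma closed_csubspace_vimage:
  assumes "bounded_clinear f" "closed_csubspace S"
  shows "closed_csubspace (f -` S)"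
  unfolding closed_csubspace_def
proof
  show "ell2.subspace (f -` S)"
    using assms closed_csubspaceD[OF assms(2)]
    by (auto simp: ell2.subspace_def bounded_clinear_add bounded_clinear_zero bounded_clinear_cscl)
  show "closed (f -` S)"
    using bounded_clinear_continuous[OF assms(1), of UNIV] closed_csubspaceD(5)[OF assms(2)]
    by (simp add: continuous_on_closed_vimage)
qed

text \<open>Together with \<open>closure_span_subset\<close> this reduces an identity of bounded
  operators on a closed span to its generators.\<close>

lemma closed_csubspace_equaliser:
  assumes "bounded_clinear f" "bounded_clinear g"
  shows "closed_csubspace {x. f x = g x}"
  using assms
  by (auto simp: closed_csubspace_def ell2.subspace_def bounded_clinear_add bounded_clinear_zero
      bounded_clinear_cscl intro!: closed_Collect_eq bounded_clinear_continuous)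

lemma bounded_clinear_cscl_const: "bounded_clinear (cscl c)"
  by (rule bounded_clinearI[where B = "norm c"]) (auto intro: ell2_eqI simp: algebra_simps)

lemma closed_csubspace_orthogonal: "closed_csubspace {x. \<forall>y\<in>A. cinner x y = 0}"
proof -
  have "{x. \<forall>y\<in>A. cinner x y = 0} = (\<Inter>y\<in>A. {x. inner x y = 0} \<inter> {x. inner x (\<i> \<cdot> y) = 0})"
    by (auto simp: cinner_Complex complex_eq_iff)
  moreover have "closed {x. inner x y = 0}" for y :: "'a ell2"
    by (intro closed_Collect_eq continuous_intros)
  ultimately have "closed {x. \<forall>y\<in>A. cinner x y = 0}"
    by (auto intro!: closed_INT closed_Int)
  then show ?thesis
    by (auto simp: closed_csubspace_def ell2.subspace_def cinner_add_left)
qed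

lemma closed_csubspace_closure:
  assumes "ell2.subspace S"
  shows "closed_csubspace (closure S)"
  unfolding closed_csubspace_def ell2.subspace_def
proof (intro conjI ballI allI)
  show "0 \<in> closure S"
    using assms closure_subset ell2.subspace_0 by blast
  show "x + y \<in> closure S" if "x \<in> closure S" "y \<in> closure S" for x y
    using that assms unfolding closure_sequential
    by (metis (mono_tags, lifting) ell2.subspace_add tendsto_add)
  show "c \<cdot> x \<in> closure S" if x: "x \<in> closure S" for c x
  proof -
    have "cscl c ` closure S \<subseteq> closure S"
      by (intro image_closure_subset bounded_clinear_continuous bounded_clinear_cscl_const)
         (use assms closure_subset in \<open>auto dest: ell2.subspace_scale\<close>)
    then show ?thesis using x by blast
  qed
qed auto

lemma closure_span_subset:
  assumes "closed_csubspace S" "A \<subseteq> S"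
  shows "closure (ell2.span A) \<subseteq> S"
  using assms by (simp add: closed_csubspace_def closure_minimal ell2.span_minimal)

section \<open>Projections, shifts and tensors\<close>

text \<open>The parallelogram law makes a minimising sequence for the distance from \<open>x\<close>
  to \<open>S\<close> Cauchy, and its limit \<open>p\<close> is a nearest point. If
  \<open>x - p\<close> were not orthogonal to some \<open>h\<close> in \<open>S\<close>, moving from
  \<open>p\<close> along \<open>h\<close> would come closer.\<close>

lemma orthogonal_projection_exists:
  fixes S :: "'a::{real_inner, complete_space} set"
  assumes "closed S" "subspace S"
  shows "\<exists>p\<in>S. \<forall>h\<in>S. inner (x - p) h = 0"
proof -
  define d where "d = infdist x S"
  have ne: "S \<noteq> {}" using subspace_0[OF assms(2)] by blast
  have d: "d \<le> norm (x - y)" if "y \<in> S" for y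
    using infdist_le[OF that, of x] by (simp add: d_def dist_norm)
  have "0 \<le> d" by (simp add: d_def infdist_nonneg)
  have "\<exists>y\<in>S. norm (x - y) < d + inverse (real (Suc n))" for n
  proof -
    have "\<not> (\<forall>y\<in>S. d + inverse (real (Suc n)) \<le> norm (x - y))"
    proof
      assume "\<forall>y\<in>S. d + inverse (real (Suc n)) \<le> norm (x - y)"
      then have "d + inverse (real (Suc n)) \<le> infdist x S"
        using ne by (auto simp: infdist_notempty dist_norm intro!: cINF_greatest)
      then show False by (simp add: d_def)
    qed
    then show ?thesis by (auto simp: not_le)
  qed
  then obtain Y where Y: "\<And>n. Y n \<in> S" "\<And>n. norm (x - Y n) < d + inverse (real (Suc n))"
    by metis
  \<comment> \<open>The midpoint of \<open>Y m\<close> and \<open>Y n\<close> lies in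
    \<open>S\<close>, so \<open>norm (u + v)\<close> is at least \<open>2 * d\<close>. The
    parallelogram law then bounds the squared difference by
    \<open>4 * (d + e)\<^sup>2 - 4 * d\<^sup>2\<close>.\<close>
  have par: "(norm (Y m - Y n))\<^sup>2 \<le> 8 * d * e + 4 * e\<^sup>2"
    if "norm (x - Y m) \<le> d + e" "norm (x - Y n) \<le> d + e" for m n e
  proof -
    define u v where "u = x - Y m" and "v = x - Y n"
    have "(1 / 2) *\<^sub>R (Y m + Y n) \<in> S"
      using Y assms(2) by (intro subspace_scale subspace_add) auto
    from d[OF this] have "d \<le> norm ((1 / 2) *\<^sub>R (u + v))"
      by (simp add: u_def v_def algebra_simps flip: scaleR_left_distrib)
    then have "(2 * d)\<^sup>2 \<le> (norm (u + v))\<^sup>2"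
      using \<open>0 \<le> d\<close> by (intro power_mono) auto
    moreover have "(norm u)\<^sup>2 \<le> (d + e)\<^sup>2" "(norm v)\<^sup>2 \<le> (d + e)\<^sup>2"
      using that by (auto intro!: power_mono simp: u_def v_def)
    moreover have "(norm (v - u))\<^sup>2 = 2 * (norm u)\<^sup>2 + 2 * (norm v)\<^sup>2 - (norm (u + v))\<^sup>2"
      by (simp add: power2_norm_eq_inner inner_simps inner_commute)
    ultimately have "(norm (v - u))\<^sup>2 \<le> 8 * d * e + 4 * e\<^sup>2"
      by (simp add: power2_sum algebra_simps)
    then show ?thesis by (simp add: u_def v_def)
  qed
  have "Cauchy Y"
    unfolding Cauchy_iff
  proof (intro allI impI)
    fix e :: real assume "0 < e"
    have "(\<lambda>n. 8 * d * inverse (real (Suc n)) + 4 * (inverse (real (Suc n)))\<^sup>2) \<longlonglongrightarrow> 8 * d * 0 + 4 * 0\<^sup>2"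
      by (intro tendsto_intros LIMSEQ_inverse_real_of_nat)
    then have "\<forall>\<^sub>F n in sequentially. 8 * d * inverse (real (Suc n)) + 4 * (inverse (real (Suc n)))\<^sup>2 < e\<^sup>2"
      using \<open>0 < e\<close> by (intro order_tendstoD) auto
    then obtain N where N: "8 * d * inverse (real (Suc N)) + 4 * (inverse (real (Suc N)))\<^sup>2 < e\<^sup>2"
      by (auto simp: eventually_sequentially)
    have "norm (Y m - Y n) < e" if "m \<ge> N" "n \<ge> N" for m n
    proof -
      have "norm (x - Y k) \<le> d + inverse (real (Suc N))" if "k \<ge> N" for k
      proof -
        have "inverse (real (Suc k)) \<le> inverse (real (Suc N))" using that by simp
        then show ?thesis using Y(2)[of k] by linarith
      qed
      from par[OF this[OF \<open>m \<ge> N\<close>] this[OF \<open>n \<ge> N\<close>]] N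
      have "(norm (Y m - Y n))\<^sup>2 < e\<^sup>2" by linarith
      then show ?thesis using \<open>0 < e\<close> by (simp add: power2_less_imp_less)
    qed
    then show "\<exists>M. \<forall>m\<ge>M. \<forall>n\<ge>M. norm (Y m - Y n) < e" by blast
  qed
  then obtain p where p: "Y \<longlonglongrightarrow> p"
    using Cauchy_convergent convergent_def by blast
  have "p \<in> S" using closed_sequentially[OF assms(1) _ p] Y by blast
  have "norm (x - p) \<le> d + 0"
  proof (rule LIMSEQ_le)
    show "(\<lambda>n. norm (x - Y n)) \<longlonglongrightarrow> norm (x - p)" by (intro tendsto_intros p)
    show "(\<lambda>n. d + inverse (real (Suc n))) \<longlonglongrightarrow> d + 0"
      by (intro tendsto_intros LIMSEQ_inverse_real_of_nat)
  qed (use Y in \<open>auto intro: less_imp_le\<close>)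
  then have min: "norm (x - p) \<le> norm (x - y)" if "y \<in> S" for y
    using d[OF that] by simp
  have "inner (x - p) h = 0" if "h \<in> S" for h
  proof (rule ccontr)
    define a where "a = inner (x - p) h"
    assume "inner (x - p) h \<noteq> 0"
    then have "a \<noteq> 0" "h \<noteq> 0" by (auto simp: a_def)
    \<comment> \<open>The step length that minimises the distance from \<open>x\<close> along
      \<open>h\<close>; it lowers the squared distance by
      \<open>a\<^sup>2 / (norm h)\<^sup>2\<close>.\<close>
    define t where "t = a / (norm h)\<^sup>2"
    have "p + t *\<^sub>R h \<in> S"
      using \<open>p \<in> S\<close> that assms(2) by (intro subspace_scale subspace_add)
    then have "(norm (x - p))\<^sup>2 \<le> (norm (x - (p + t *\<^sub>R h)))\<^sup>2"
      using min by (intro power_mono) auto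
    also have "(norm (x - (p + t *\<^sub>R h)))\<^sup>2 = (norm ((x - p) - t *\<^sub>R h))\<^sup>2"
      by (simp add: algebra_simps)
    also have "\<dots> = (norm (x - p))\<^sup>2 - 2 * t * a + t\<^sup>2 * (norm h)\<^sup>2"
    proof -
      have "(norm (w - t *\<^sub>R h))\<^sup>2 = (norm w)\<^sup>2 - 2 * t * inner w h + t\<^sup>2 * (norm h)\<^sup>2" for w
        unfolding power2_norm_eq_inner
        by (simp add: inner_diff_left inner_diff_right inner_commute[of h w] power2_eq_square algebra_simps)
      then show ?thesis by (simp add: a_def)
    qed
    also have "\<dots> = (norm (x - p))\<^sup>2 - a\<^sup>2 / (norm h)\<^sup>2"
      using \<open>h \<noteq> 0\<close> by (simp add: t_def power2_eq_square)
    finally show False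
      using \<open>a \<noteq> 0\<close> \<open>h \<noteq> 0\<close> by (simp add: divide_le_0_iff)
  qed
  then show ?thesis using \<open>p \<in> S\<close> by blast
qed

definition eproj :: "'a ell2 set \<Rightarrow> 'a ell2 \<Rightarrow> 'a ell2" where
  "eproj S x = (THE p. p \<in> S \<and> (\<forall>h\<in>S. cinner (x - p) h = 0))"

lemma eproj_unique:
  assumes "closed_csubspace S" "p \<in> S" "\<And>h. h \<in> S \<Longrightarrow> cinner (x - p) h = 0"
    "q \<in> S" "\<And>h. h \<in> S \<Longrightarrow> cinner (x - q) h = 0"
  shows "q = p"
proof -
  have "q - p \<in> S" using closed_csubspaceD(4)[OF assms(1)] assms by blast
  with assms(3,5) have "cinner ((x - p) - (x - q)) (q - p) = 0"
    unfolding cinner_diff_left by simp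
  then have "cinner (q - p) (q - p) = 0" by simp
  then show ?thesis unfolding cinner_eq_zero by simp
qed

lemma eproj_exists:
  assumes "closed_csubspace S"
  shows "\<exists>p\<in>S. \<forall>h\<in>S. cinner (x - p) h = 0"
proof -
  have "subspace S"
    unfolding subspace_def using closed_csubspaceD[OF assms] by (auto simp: scaleR_ell2_def)
  then obtain p where p: "p \<in> S" "\<forall>h\<in>S. inner (x - p) h = 0"
    using orthogonal_projection_exists[of S x] closed_csubspaceD[OF assms] by auto
  moreover have "\<forall>h\<in>S. cinner (x - p) h = 0"
    using p closed_csubspaceD(3)[OF assms] by (auto simp: cinner_Complex complex_eq_iff)
  ultimately show ?thesis by blast
qed

lemma eproj_works:
  assumes "closed_csubspace S"
  shows "eproj S x \<in> S \<and> (\<forall>h\<in>S. cinner (x - eproj S x) h = 0)"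
  unfolding eproj_def
  by (rule theI') (use eproj_exists[OF assms] eproj_unique[OF assms] in blast)

lemma eproj_in: "closed_csubspace S \<Longrightarrow> eproj S x \<in> S"
  using eproj_works by blast

lemma cinner_eproj_left: "closed_csubspace S \<Longrightarrow> h \<in> S \<Longrightarrow> cinner (eproj S x) h = cinner x h"
  using eproj_works[of S x] by (simp add: cinner_diff_left)

lemma cinner_eproj_right: "closed_csubspace S \<Longrightarrow> h \<in> S \<Longrightarrow> cinner h (eproj S x) = cinner h x"
  using cinner_eproj_left by (metis cnj_cinner)

lemma eproj_eqI:
  assumes "closed_csubspace S" "p \<in> S" "\<And>h. h \<in> S \<Longrightarrow> cinner p h = cinner x h"
  shows "eproj S x = p"
  using eproj_works[OF assms(1), of x] assms
  by (intro eproj_unique[of S p x]) (auto simp: cinner_diff_left)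

lemma eproj_id: "closed_csubspace S \<Longrightarrow> x \<in> S \<Longrightarrow> eproj S x = x"
  by (rule eproj_eqI) auto

lemma norm_eproj_le:
  assumes S: "closed_csubspace S"
  shows "norm (eproj S x) \<le> norm x"
proof -
  have "(norm (eproj S x))\<^sup>2 = Re (cinner (eproj S x) (eproj S x))"
    by (simp add: cinner_norm)
  also have "\<dots> = inner x (eproj S x)"
    using cinner_eproj_left[OF S eproj_in[OF S]] by (simp add: inner_ell2_def)
  also have "\<dots> \<le> norm x * norm (eproj S x)"
    by (rule norm_cauchy_schwarz)
  finally have "norm (eproj S x) * norm (eproj S x) \<le> norm x * norm (eproj S x)"
    by (simp add: power2_eq_square)
  then show ?thesis
    by (metis mult_right_le_imp_le norm_ge_zero order_le_less)
qed

lemma bounded_clinear_eproj: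
  assumes S: "closed_csubspace S"
  shows "bounded_clinear (eproj S)"
  by (rule bounded_clinearI[where B = 1])
     (auto intro!: eproj_eqI[OF S] closed_csubspaceD[OF S] eproj_in[OF S] norm_eproj_le[OF S]
       simp: cinner_add_left cinner_eproj_left[OF S])

section \<open>Monomials, shifts and slices on multi-indexed families\<close>

definition ebasis :: "'a \<Rightarrow> 'a ell2" where
  "ebasis k = Abs_ell2 (\<lambda>l. if l = k then 1 else 0)"

lemma coef_ebasis [simp]: "coef (ebasis k) l = (if l = k then 1 else 0)"
proof -
  have "square_summable (\<lambda>l. if l = k then 1 else 0)"
  proof (rule square_summableI_bounded)
    fix F :: "'a set" assume "finite F"
    then show "(\<Sum>l\<in>F. (norm (if l = k then 1 else 0 :: complex))\<^sup>2) \<le> 1"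
      by (simp add: if_distrib[of norm] if_distrib[of "\<lambda>x. x\<^sup>2"] cong: if_cong)
  qed
  then show ?thesis by (simp add: ebasis_def coef_Abs_ell2)
qed

lemma cinner_ebasis_right [simp]: "cinner x (ebasis k) = coef x k"
proof -
  have "cinner x (ebasis k) = (\<Sum>\<^sub>\<infinity>l\<in>{k}. coef x l)"
    unfolding cinner.rep_eq by (rule infsum_cong_neutral) auto
  then show ?thesis by simp
qed

lemma square_summable_extend:
  assumes "square_summable (\<lambda>k. f (h k))" "inj h" "\<And>k. k \<notin> range h \<Longrightarrow> f k = 0"
  shows "square_summable f"
proof -
  have "(\<lambda>k. (norm (f k))\<^sup>2) summable_on range h"
    using assms(1,2) by (simp add: square_summable_def summable_on_reindex o_def)
  moreover have "(\<lambda>k. (norm (f k))\<^sup>2) summable_on range h \<longleftrightarrow> (\<lambda>k. (norm (f k))\<^sup>2) summable_on UNIV"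
    by (rule summable_on_cong_neutral) (auto simp: assms(3))
  ultimately show ?thesis by (simp add: square_summable_def)
qed

definition inc :: "'n \<Rightarrow> ('n \<Rightarrow> nat) \<Rightarrow> 'n \<Rightarrow> nat" where
  "inc i k = k(i := Suc (k i))"

definition dec :: "'n \<Rightarrow> ('n \<Rightarrow> nat) \<Rightarrow> 'n \<Rightarrow> nat" where
  "dec i k = k(i := k i - 1)"

lemma inc_apply [simp]: "inc i k j = (if j = i then Suc (k i) else k j)"
  by (simp add: inc_def)

lemma dec_apply [simp]: "dec i k j = (if j = i then k i - 1 else k j)"
  by (simp add: dec_def)

lemma dec_inc [simp]: "dec i (inc i k) = k"
  by (auto simp: fun_eq_iff)

lemma inc_dec [simp]: "k i \<noteq> 0 \<Longrightarrow> inc i (dec i k) = k"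
  by (auto simp: fun_eq_iff)

lemma inc_commute: "inc i (inc j k) = inc j (inc i k)"
  by (auto simp: fun_eq_iff)

lemma dec_commute: "dec i (dec j k) = dec j (dec i k)"
  by (auto simp: fun_eq_iff)

lemma inj_inc: "inj (inc i)"
  by (metis dec_inc injI)

lemma range_inc: "k \<notin> range (inc i) \<longleftrightarrow> k i = 0"
proof (cases "k i = 0")
  case True
  then show ?thesis by (auto simp: inc_def dest: fun_cong[of _ _ i])
next
  case False
  then have "k = inc i (dec i k)" by simp
  then show ?thesis using False by blast
qed

text \<open>On Taylor coefficients this is multiplication by the i-th coordinate.\<close>

lift_definition sh :: "'n \<Rightarrow> ('n \<Rightarrow> nat) ell2 \<Rightarrow> ('n \<Rightarrow> nat) ell2"
  is "\<lambda>i f k. if k i = 0 then 0 else f (dec i k)"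
proof -
  fix i and f :: "('n \<Rightarrow> nat) \<Rightarrow> complex" assume "square_summable f"
  then show "square_summable (\<lambda>k. if k i = 0 then 0 else f (dec i k))"
    by (rule_tac h = "inc i" in square_summable_extend) (auto simp: range_inc inj_inc)
qed

text \<open>The backward shift, which is the Hilbert space adjoint of \<open>sh i\<close> by
  \<open>cinner_sh_left\<close>.\<close>

lift_definition bs :: "'n \<Rightarrow> ('n \<Rightarrow> nat) ell2 \<Rightarrow> ('n \<Rightarrow> nat) ell2"
  is "\<lambda>i f k. f (inc i k)"
  by (rule square_summable_inj[OF _ inj_inc])

text \<open>The orthogonal projection onto the series free of the variables in \<open>F\<close>; by
  \<open>slice0_insert\<close> it is the product over \<open>i\<close> in \<open>F\<close> of the
  operators \<open>x \<mapsto> x - sh i (bs i x)\<close>.\<close>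

lift_definition slice0 :: "'n set \<Rightarrow> ('n \<Rightarrow> nat) ell2 \<Rightarrow> ('n \<Rightarrow> nat) ell2"
  is "\<lambda>F f k. if \<forall>i\<in>F. k i = 0 then f k else 0"
  by (erule square_summable_le) auto

lemma coef_sh [simp]: "coef (sh i x) k = (if k i = 0 then 0 else coef x (dec i k))"
  by (simp add: sh.rep_eq)

lemma coef_bs [simp]: "coef (bs i x) k = coef x (inc i k)"
  by (simp add: bs.rep_eq)

lemma coef_slice0 [simp]: "coef (slice0 F x) k = (if \<forall>i\<in>F. k i = 0 then coef x k else 0)"
  by (simp add: slice0.rep_eq)

lemma bs_sh [simp]: "bs i (sh i x) = x"
  by (rule ell2_eqI) simp

lemma cinner_sh_left: "cinner (sh i x) y = cinner x (bs i y)"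
proof -
  have "cinner (sh i x) y = (\<Sum>\<^sub>\<infinity>k\<in>range (inc i). coef (sh i x) k * cnj (coef y k))"
    unfolding cinner.rep_eq by (rule infsum_cong_neutral) (auto simp: range_inc)
  also have "\<dots> = (\<Sum>\<^sub>\<infinity>k. coef (sh i x) (inc i k) * cnj (coef y (inc i k)))"
    by (simp add: infsum_reindex[OF inj_inc] o_def)
  finally show ?thesis by (simp add: cinner.rep_eq)
qed

lemma norm_sh [simp]: "norm (sh i x) = norm x"
  by (simp add: norm_ell2_def inner_ell2_def cinner_sh_left)

lemma norm_bs_le: "norm (bs i x) \<le> norm x"
proof (rule norm_ell2_leI)
  fix F :: "('a \<Rightarrow> nat) set" assume "finite F"
  then have "(\<Sum>k\<in>inc i ` F. (norm (coef x k))\<^sup>2) \<le> (norm x)\<^sup>2"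
    by (intro sum_coef_le_norm) auto
  then show "(\<Sum>k\<in>F. (norm (coef (bs i x) k))\<^sup>2) \<le> (norm x)\<^sup>2"
    by (simp add: sum.reindex inj_on_subset[OF inj_inc])
qed auto

lemma bounded_clinear_sh: "bounded_clinear (sh i)"
  by (rule bounded_clinearI[where B = 1]) (auto intro: ell2_eqI)

lemma bounded_clinear_bs: "bounded_clinear (bs i)"
  by (rule bounded_clinearI[where B = 1]) (auto intro: ell2_eqI simp: norm_bs_le)

lemma slice0_insert: "slice0 (insert j F) x = slice0 F x - sh j (bs j (slice0 F x))"
  by (rule ell2_eqI) auto

lemma slice0_bs: "j \<notin> F \<Longrightarrow> slice0 F (bs j x) = bs j (slice0 F x)"
  by (rule ell2_eqI) auto

lemma slice0_empty [simp]: "slice0 {} x = x"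
  by (rule ell2_eqI) auto

lemma slice0_UNIV: "slice0 UNIV x = coef x (\<lambda>_. 0) \<cdot> ebasis (\<lambda>_. 0)"
proof (rule ell2_eqI)
  fix k :: "'a \<Rightarrow> nat"
  show "coef (slice0 UNIV x) k = coef (coef x (\<lambda>_. 0) \<cdot> ebasis (\<lambda>_. 0)) k"
    by (cases "k = (\<lambda>_. 0)") (simp, auto simp: fun_eq_iff)
qed

lemma cinner_slice0: "cinner (slice0 F x) y = cinner x (slice0 F y)"
  unfolding cinner.rep_eq by (rule infsum_cong) auto

lemma sh_ebasis: "sh i (ebasis k) = ebasis (inc i k)"
  by (rule ell2_eqI) auto

text \<open>\<open>(1 \<Rightarrow> nat) ell2\<close> is the coefficient space of the disc; its indices are constant functions.\<close>

lemma bij_const_num1: "bij (\<lambda>m :: nat. \<lambda>_ :: 1. m)"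
proof (rule bijI)
  show "inj (\<lambda>m :: nat. \<lambda>_ :: 1. m)" by (auto intro: injI dest: fun_cong)
  have "f = (\<lambda>_. f 1)" for f :: "1 \<Rightarrow> nat" by (auto simp: fun_eq_iff)
  then show "surj (\<lambda>m :: nat. \<lambda>_ :: 1. m)" by blast
qed

section \<open>Elementary tensors\<close>

lemma abs_summable_prod:
  fixes f :: "'n::finite \<Rightarrow> nat \<Rightarrow> complex"
  assumes "\<And>i. (\<lambda>m. norm (f i m)) summable_on UNIV"
  shows "(\<lambda>k. norm (\<Prod>i\<in>UNIV. f i (k i))) summable_on UNIV"
proof -
  have "Infinite_Set_Sum.abs_summable_on (\<lambda>k. \<Prod>i\<in>UNIV. f i (k i)) (PiE UNIV (\<lambda>_. UNIV))"
    using assms by (intro abs_summable_on_prod_PiE) (auto simp: abs_summable_equivalent[symmetric])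
  then show ?thesis by (simp add: abs_summable_equivalent[symmetric] PiE_UNIV_domain)
qed

lemma infsum_prod:
  fixes f :: "'n::finite \<Rightarrow> nat \<Rightarrow> complex"
  assumes "\<And>i. (\<lambda>m. norm (f i m)) summable_on UNIV"
  shows "(\<Sum>\<^sub>\<infinity>k. \<Prod>i\<in>UNIV. f i (k i)) = (\<Prod>i\<in>UNIV. \<Sum>\<^sub>\<infinity>m. f i m)"
  using infsum_prod_PiE_abs[of UNIV f "\<lambda>_. UNIV"] assms by (simp add: PiE_UNIV_domain)

lift_definition tens :: "('n::finite \<Rightarrow> (1 \<Rightarrow> nat) ell2) \<Rightarrow> ('n \<Rightarrow> nat) ell2"
  is "\<lambda>f k. \<Prod>i\<in>UNIV. f i (\<lambda>_. k i)"
proof -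
  fix f :: "'n \<Rightarrow> (1 \<Rightarrow> nat) \<Rightarrow> complex" assume "\<And>i. square_summable (f i)"
  then have "square_summable (\<lambda>m. f i (\<lambda>_. m))" for i
    by (rule square_summable_inj) (rule bij_is_inj[OF bij_const_num1])
  then show "square_summable (\<lambda>k. \<Prod>i\<in>UNIV. f i (\<lambda>_. k i))"
    using abs_summable_prod[of "\<lambda>i m. (f i (\<lambda>_. m))\<^sup>2"]
    by (simp add: square_summable_def norm_power prod_power_distrib[symmetric] prod_norm)
qed

lemma coef_tens: "coef (tens f) k = (\<Prod>i\<in>UNIV. coef (f i) (\<lambda>_. k i))"
  by (simp add: tens.rep_eq)

lemma cinner_tens: "cinner (tens f) (tens g) = (\<Prod>i\<in>UNIV. cinner (f i) (g i))"
proof -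
  have *: "cinner x y = (\<Sum>\<^sub>\<infinity>m. coef x (\<lambda>_. m) * cnj (coef y (\<lambda>_. m)))" for x y :: "(1 \<Rightarrow> nat) ell2"
    unfolding cinner.rep_eq using infsum_reindex_bij_betw[OF bij_const_num1] by (rule sym)
  have "(\<lambda>m. norm (coef x (\<lambda>_. m) * cnj (coef y (\<lambda>_. m)))) summable_on UNIV" for x y :: "(1 \<Rightarrow> nat) ell2"
    using square_summable_inj[OF square_summable_coef bij_is_inj[OF bij_const_num1]]
    by (intro square_summable_mult square_summable_cnj) auto
  from infsum_prod[OF this, of f g] show ?thesis
    by (simp add: * cinner.rep_eq[of "tens f"] coef_tens prod.distrib)
qed

lemma norm_tens: "norm (tens f) = (\<Prod>i\<in>UNIV. norm (f i))"
proof -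
  have "complex_of_real ((norm (tens f))\<^sup>2) = complex_of_real ((\<Prod>i\<in>UNIV. norm (f i))\<^sup>2)"
    unfolding cinner_norm[symmetric] cinner_tens by (simp add: cinner_norm prod_power_distrib)
  then show ?thesis
    unfolding of_real_eq_iff by (simp add: power2_eq_iff_nonneg prod_nonneg)
qed

lemma coef_tens_remove:
  "coef (tens f) k = coef (f i) (\<lambda>_. k i) * (\<Prod>j\<in>UNIV-{i}. coef (f j) (\<lambda>_. k j))"
  by (simp add: coef_tens prod.remove[of _ i])

lemma coef_tens_upd:
  "coef (tens (f(i := x))) k = coef x (\<lambda>_. k i) * (\<Prod>j\<in>UNIV-{i}. coef (f j) (\<lambda>_. k j))"
  by (subst coef_tens_remove[of _ _ i]) (auto intro!: prod.cong)

lemma cinner_tens_upd: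
  "cinner (tens (f(i := x))) (tens g) = cinner x (g i) * (\<Prod>j\<in>UNIV-{i}. cinner (f j) (g j))"
  by (subst cinner_tens, subst prod.remove[of _ i]) (auto intro!: prod.cong)

text \<open>Filling one slot while the others are held fixed is a bounded operator, so the entries
  whose tensor lies in a given closed subspace form a closed subspace.\<close>

lemma bounded_clinear_tens_upd: "bounded_clinear (\<lambda>x. tens (f(i := x)))"
proof (rule bounded_clinearI)
  fix x
  show "norm (tens (f(i := x))) \<le> norm x * (\<Prod>j\<in>UNIV-{i}. norm (f j))"
    by (subst norm_tens, subst prod.remove[of _ i]) (auto intro!: prod.cong)
qed (auto intro!: ell2_eqI simp: coef_tens_upd algebra_simps)

lemma sh_tens: "sh i (tens f) = tens (f(i := sh 1 (f i)))"
proof (rule ell2_eqI)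
  fix k
  have "dec 1 (\<lambda>_. k i) = (\<lambda>_ :: 1. dec i k i)" by (auto simp: fun_eq_iff)
  then show "coef (sh i (tens f)) k = coef (tens (f(i := sh 1 (f i)))) k"
    unfolding coef_tens_upd coef_sh coef_tens_remove[of f _ i] by (auto intro!: prod.cong)
qed

lemma bs_tens: "bs i (tens f) = tens (f(i := bs 1 (f i)))"
proof (rule ell2_eqI)
  fix k
  have "inc 1 (\<lambda>_. k i) = (\<lambda>_ :: 1. inc i k i)" by (auto simp: fun_eq_iff)
  then show "coef (bs i (tens f)) k = coef (tens (f(i := bs 1 (f i)))) k"
    unfolding coef_tens_upd coef_bs coef_tens_remove[of f _ i] by (auto intro!: prod.cong)
qed

section \<open>Doubly commuting backward shift invariant subspaces\<close>

lemma sh_sh: "sh i (sh j x) = sh j (sh i x)"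
  by (rule ell2_eqI) (auto simp: dec_commute)

lemma bs_bs: "bs i (bs j x) = bs j (bs i x)"
  by (rule ell2_eqI) (simp add: inc_commute)

text \<open>The coefficient side of a quotient module; \<open>quotient_module_hfun\<close> makes the
  correspondence exact.\<close>

locale backward_invariant =
  fixes S :: "('n::finite \<Rightarrow> nat) ell2 set"
  assumes closed: "closed_csubspace S" and bs_in: "x \<in> S \<Longrightarrow> bs i x \<in> S"
begin

text \<open>The operator \<open>C\<^sub>i\<close>, defined on the whole space; on \<open>S\<close>
  its adjoint is \<open>bs i\<close> by \<open>cinner_cshift\<close>.\<close>

definition cshift :: "'n \<Rightarrow> ('n \<Rightarrow> nat) ell2 \<Rightarrow> ('n \<Rightarrow> nat) ell2" where
  "cshift i x = eproj S (sh i x)"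

lemmas S_simps = closed_csubspaceD[OF closed]

lemmas proj_in [simp] = eproj_in[OF closed]

lemma cshift_in [simp]: "cshift i x \<in> S"
  by (simp add: cshift_def)

lemma bounded_clinear_cshift: "bounded_clinear (cshift i)"
  unfolding cshift_def
  by (rule bounded_clinear_compose[OF bounded_clinear_eproj[OF closed] bounded_clinear_sh])

text \<open>The orthogonal complement of \<open>S\<close> is invariant under \<open>sh i\<close>,
  because \<open>S\<close> is invariant under the adjoint. Hence the component of \<open>x\<close>
  orthogonal to \<open>S\<close> contributes nothing after the shift and the final
  projection.\<close>

lemma cshift_proj: "cshift i (eproj S x) = eproj S (sh i x)"
  unfolding cshift_def
  by (rule eproj_eqI[OF closed])
     (simp_all add: cinner_eproj_left[OF closed] cinner_sh_left bs_in)

lemma cinner_cshift: "y \<in> S \<Longrightarrow> cinner (cshift i x) y = cinner x (bs i y)"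
  by (simp add: cshift_def cinner_eproj_left[OF closed] cinner_sh_left)

lemma cshift_cshift: "cshift i (cshift j x) = cshift j (cshift i x)"
  unfolding cshift_def[of j x] cshift_def[of i x] cshift_proj by (simp add: sh_sh)

end

section \<open>Defect operators under double commutation\<close>

locale doubly_commuting_module = backward_invariant S
  for S :: "('n::finite \<Rightarrow> nat) ell2 set" +
  assumes cshift_bs: "i \<noteq> j \<Longrightarrow> x \<in> S \<Longrightarrow> cshift i (bs j x) = bs j (cshift i x)"
begin

text \<open>By \<open>defect_insert\<close> this acts on \<open>S\<close> as the product of the
  \<open>D\<^sub>i\<close> with \<open>i\<close> in \<open>F\<close>. Compressing
  \<open>slice0 F\<close> makes it independent of any order on \<open>F\<close> and visibly
  self-adjoint.\<close>

definition defect :: "'n set \<Rightarrow> ('n \<Rightarrow> nat) ell2 \<Rightarrow> ('n \<Rightarrow> nat) ell2" where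
  "defect F x = eproj S (slice0 F x)"

definition proj_one :: "('n \<Rightarrow> nat) ell2" where "proj_one = eproj S (ebasis (\<lambda>_. 0))"

lemma defect_in [simp]: "defect F x \<in> S"
  by (simp add: defect_def)

lemma proj_one_in [simp]: "proj_one \<in> S"
  by (simp add: proj_one_def)

text \<open>Projecting \<open>slice0_insert\<close> onto \<open>S\<close> turns \<open>sh j\<close>
  into \<open>cshift j\<close>. The commutation is kept as a premise because
  \<open>defect_commute\<close> uses this recursion inside its own induction.\<close>

lemma defect_insert_aux:
  assumes "j \<notin> F" "defect F (bs j x) = bs j (defect F x)"
  shows "defect (insert j F) x = defect F x - cshift j (bs j (defect F x))"
proof -
  have "defect (insert j F) x = defect F x - cshift j (defect F (bs j x))"
    unfolding defect_def cshift_proj slice0_insert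
    by (simp add: bounded_clinear_diff[OF bounded_clinear_eproj[OF closed]] slice0_bs[OF assms(1)])
  then show ?thesis by (simp add: assms(2))
qed

text \<open>For \<open>j\<close> different from \<open>i\<close>, the factor
  \<open>D\<^sub>j\<close> commutes with \<open>cshift i\<close> and \<open>bs i\<close>: mixed
  pairs commute by double commutation, and compressions as well as backward shifts commute among
  themselves.\<close>

lemma defect_commute:
  assumes "x \<in> S" "i \<notin> F"
  shows "defect F (bs i x) = bs i (defect F x) \<and> defect F (cshift i x) = cshift i (defect F x)"
proof -
  have "finite F" by simp
  then show ?thesis
    using assms
  proof (induction F arbitrary: x i rule: finite_induct)
    case empty
    then show ?case by (simp add: defect_def eproj_id[OF closed] bs_in)
  next
    case (insert j F)
    note D = defect_insert_aux[OF insert.hyps(2)]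
    have ij: "i \<noteq> j" "i \<notin> F" using insert.prems by auto
    have x: "bs i x \<in> S" "cshift i x \<in> S" using insert.prems bs_in by auto
    \<comment> \<open>The third identity, available because \<open>j \<notin> F\<close>, is the
      premise of \<open>defect_insert_aux\<close>.\<close>
    have IH: "defect F (bs i y) = bs i (defect F y)" "defect F (cshift i y) = cshift i (defect F y)"
      "defect F (bs j y) = bs j (defect F y)" if "y \<in> S" for y
      using insert.IH[OF that] ij insert.hyps(2) by auto
    let ?y = "defect F x"
    have y: "?y \<in> S" "bs j ?y \<in> S" by (auto intro: bs_in)
    have "defect (insert j F) (bs i x) = bs i ?y - cshift j (bs j (bs i ?y))"
      using insert.prems x by (simp add: D IH)
    also have "\<dots> = bs i (?y - cshift j (bs j ?y))"
      using ij y by (simp add: bounded_clinear_diff[OF bounded_clinear_bs] bs_bs[of j i] cshift_bs)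
    also have "\<dots> = bs i (defect (insert j F) x)"
      using insert.prems by (simp add: D IH)
    finally have 1: "defect (insert j F) (bs i x) = bs i (defect (insert j F) x)" .
    have "defect (insert j F) (cshift i x) = cshift i ?y - cshift j (bs j (cshift i ?y))"
      using insert.prems x by (simp add: D IH)
    also have "\<dots> = cshift i (?y - cshift j (bs j ?y))"
      using ij y
      by (simp add: bounded_clinear_diff[OF bounded_clinear_cshift] cshift_cshift[of i j] cshift_bs[of i j])
    also have "\<dots> = cshift i (defect (insert j F) x)"
      using insert.prems by (simp add: D IH)
    finally show ?case using 1 by simp
  qed
qed

lemma defect_insert:
  "j \<notin> F \<Longrightarrow> x \<in> S \<Longrightarrow> defect (insert j F) x = defect F x - cshift j (bs j (defect F x))"
  by (rule defect_insert_aux) (simp_all add: defect_commute)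

lemma defect_empty [simp]: "x \<in> S \<Longrightarrow> defect {} x = x"
  by (simp add: defect_def eproj_id[OF closed])

lemma cinner_defect: "x \<in> S \<Longrightarrow> y \<in> S \<Longrightarrow> cinner (defect F x) y = cinner x (defect F y)"
  by (simp add: defect_def cinner_eproj_left[OF closed] cinner_eproj_right[OF closed] cinner_slice0)

lemma bounded_clinear_slice0: "bounded_clinear (slice0 F :: ('n \<Rightarrow> nat) ell2 \<Rightarrow> _)"
proof (rule bounded_clinearI)
  fix x :: "('n \<Rightarrow> nat) ell2"
  show "norm (slice0 F x) \<le> norm x * 1"
  proof (rule norm_ell2_leI)
    fix A :: "('n \<Rightarrow> nat) set" assume "finite A"
    have "(\<Sum>k\<in>A. (norm (coef (slice0 F x) k))\<^sup>2) \<le> (\<Sum>k\<in>A. (norm (coef x k))\<^sup>2)"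
      by (intro sum_mono) auto
    also have "\<dots> \<le> (norm x * 1)\<^sup>2"
      using sum_coef_le_norm[OF \<open>finite A\<close>] by simp
    finally show "(\<Sum>k\<in>A. (norm (coef (slice0 F x) k))\<^sup>2) \<le> (norm x * 1)\<^sup>2" .
  qed simp
qed (auto intro!: ell2_eqI)

lemma bounded_clinear_defect: "bounded_clinear (defect F)"
  unfolding defect_def
  by (rule bounded_clinear_compose[OF bounded_clinear_eproj[OF closed] bounded_clinear_slice0])

lemma cinner_proj_one: "x \<in> S \<Longrightarrow> cinner x proj_one = coef x (\<lambda>_. 0)"
  by (simp add: proj_one_def cinner_eproj_right[OF closed])

text \<open>Slicing in all variables keeps only the constant term, so the compression is the rank
  one operator given by \<open>proj_one\<close>.\<close>

lemma defect_UNIV: "x \<in> S \<Longrightarrow> defect UNIV x = cinner x proj_one \<cdot> proj_one"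
  by (simp add: defect_def slice0_UNIV cinner_proj_one bounded_clinear_cscl[OF bounded_clinear_eproj[OF closed]])
     (simp add: proj_one_def)

text \<open>Inserting \<open>i\<close> into its complement gives the first identity by the
  recursion; the second follows because the defect of the complement commutes with
  \<open>cshift i\<close> and \<open>bs i\<close>.\<close>

lemma defect_split:
  assumes "x \<in> S"
  shows "defect {i} (defect (-{i}) x) = defect UNIV x" "defect (-{i}) (defect {i} x) = defect UNIV x"
proof -
  have U: "insert i (-{i}) = UNIV" by auto
  have *: "defect UNIV x = defect (-{i}) x - cshift i (bs i (defect (-{i}) x))"
    using defect_insert[of i "-{i}" x] assms by (simp add: U)
  have **: "defect {i} y = y - cshift i (bs i y)" if "y \<in> S" for y
    using defect_insert[of i "{}" y] that by simp
  show "defect {i} (defect (-{i}) x) = defect UNIV x"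
    by (simp add: * **)
  show "defect (-{i}) (defect {i} x) = defect UNIV x"
    using assms bs_in
    by (simp add: * ** bounded_clinear_diff[OF bounded_clinear_defect] defect_commute)
qed

text \<open>The second operator is the adjoint of the first on \<open>S\<close>, composed in reverse
  order. Carrying it in the relation provides every word with an adjoint that is again a word, see
  \<open>word_adjoint\<close> and \<open>word_swap\<close>.\<close>

inductive word :: "'n set \<Rightarrow> (('n \<Rightarrow> nat) ell2 \<Rightarrow> ('n \<Rightarrow> nat) ell2) \<Rightarrow>
    (('n \<Rightarrow> nat) ell2 \<Rightarrow> ('n \<Rightarrow> nat) ell2) \<Rightarrow> bool" for F where
  word_id: "word F (\<lambda>x. x) (\<lambda>x. x)"
| word_cshift: "word F T T' \<Longrightarrow> i \<in> F \<Longrightarrow> word F (\<lambda>x. cshift i (T x)) (\<lambda>x. T' (bs i x))"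
| word_bs: "word F T T' \<Longrightarrow> i \<in> F \<Longrightarrow> word F (\<lambda>x. bs i (T x)) (\<lambda>x. T' (cshift i x))"

lemma word_in: "word F T T' \<Longrightarrow> x \<in> S \<Longrightarrow> T x \<in> S \<and> T' x \<in> S"
  by (induction arbitrary: x rule: word.induct) (auto intro: bs_in)

lemma word_cscl: "word F T T' \<Longrightarrow> T (c \<cdot> x) = c \<cdot> T x"
  by (induction arbitrary: x rule: word.induct)
     (simp_all add: bounded_clinear_cscl[OF bounded_clinear_cshift] bounded_clinear_cscl[OF bounded_clinear_bs])

lemma cinner_bs_cshift: "x \<in> S \<Longrightarrow> cinner (bs i x) y = cinner x (cshift i y)"
  by (metis cinner_cshift cnj_cinner)

lemma word_adjoint: "word F T T' \<Longrightarrow> x \<in> S \<Longrightarrow> y \<in> S \<Longrightarrow> cinner (T x) y = cinner x (T' y)"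
proof (induction arbitrary: x y rule: word.induct)
  case (word_cshift T T' i)
  then show ?case using bs_in by (simp add: cinner_cshift)
next
  case (word_bs T T' i)
  then show ?case using word_in[OF word_bs.hyps(1)] by (simp add: cinner_bs_cshift)
qed simp

lemma word_compose:
  "word F T T' \<Longrightarrow> word F U U' \<Longrightarrow> word F (\<lambda>x. T (U x)) (\<lambda>x. U' (T' x))"
  by (induction rule: word.induct) (auto intro: word.intros)

lemma word_swap: "word F T T' \<Longrightarrow> word F T' T"
proof (induction rule: word.induct)
  case (word_cshift T T' i)
  from word_compose[OF word_cshift.IH word.word_bs[OF word_id word_cshift.hyps(2)]] show ?case by simp
next
  case (word_bs T T' i)
  from word_compose[OF word_bs.IH word.word_cshift[OF word_id word_bs.hyps(2)]] show ?case by simp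
qed (rule word_id)

lemma word_commute:
  assumes "word F T T'" "x \<in> S" "\<And>y. y \<in> S \<Longrightarrow> U y \<in> S"
    "\<And>i y. i \<in> F \<Longrightarrow> y \<in> S \<Longrightarrow> U (cshift i y) = cshift i (U y)"
    "\<And>i y. i \<in> F \<Longrightarrow> y \<in> S \<Longrightarrow> U (bs i y) = bs i (U y)"
  shows "U (T x) = T (U x)"
  using assms
  by (induction arbitrary: x rule: word.induct) (simp_all add: word_in)

lemma word_commute_defect:
  assumes "word F T T'" "x \<in> S" "F \<inter> G = {}"
  shows "defect G (T x) = T (defect G x)"
  by (rule word_commute[OF assms(1,2)]) (use assms(3) in \<open>auto simp: defect_commute disjoint_iff\<close>)

lemma word_commute_word:
  assumes "word F T T'" "word G U U'" "x \<in> S" "F \<inter> G = {}"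
  shows "U (T x) = T (U x)"
proof (rule word_commute[OF assms(1,3)])
  fix i y assume i: "i \<in> F" and y: "y \<in> S"
  have "i \<notin> G" using i assms(4) by blast
  have "cshift i (U y) = U (cshift i y)"
    by (rule word_commute[OF assms(2) y]) (use \<open>i \<notin> G\<close> in \<open>auto simp: cshift_cshift intro!: cshift_bs\<close>)
  then show "U (cshift i y) = cshift i (U y)" by simp
  have "bs i (U y) = U (bs i y)"
    by (rule word_commute[OF assms(2) y])
       (use \<open>i \<notin> G\<close> in \<open>auto simp: bs_bs bs_in intro!: cshift_bs[symmetric]\<close>)
  then show "U (bs i y) = bs i (U y)" by simp
qed (use word_in[OF assms(2)] in blast)

text \<open>\<open>A\<close> involves the variables other than \<open>i\<close> and commutes with
  \<open>X\<close>; \<open>B\<close> involves \<open>i\<close> and commutes with \<open>Y\<close>.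
  Inserting both at \<open>proj_one\<close> costs the factor \<open>s\<close>. Moved to the same
  side they form the rank one operator of \<open>defect_UNIV\<close>, which separates the inner
  product.\<close>

lemma cinner_word_proj_one:
  assumes X: "word {i} X X'" and Y: "word (-{i}) Y Y'"
  shows "cinner proj_one proj_one * cinner (X proj_one) (Y proj_one) = cinner (X proj_one) proj_one * cinner proj_one (Y proj_one)"
proof (cases "proj_one = 0")
  case True
  then show ?thesis by simp
next
  case False
  define s where "s = cinner proj_one proj_one"
  have s: "s \<noteq> 0" "cnj s = s" using False by (auto simp: s_def cnj_cinner)
  define A B where "A = defect (-{i})" and "B = defect {i}"
  note defs = A_def B_def
  have in_S: "A x \<in> S" "B x \<in> S" for x by (auto simp: defs)
  have AB: "A (B x) = cinner x proj_one \<cdot> proj_one" "B (A x) = cinner x proj_one \<cdot> proj_one" if "x \<in> S" for x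
    using that by (simp_all add: defs defect_split defect_UNIV)
  have lin: "A (c \<cdot> x) = c \<cdot> A x" "B (c \<cdot> x) = c \<cdot> B x" for c x
    by (simp_all add: defs bounded_clinear_cscl[OF bounded_clinear_defect])
  define \<alpha> \<beta> where "\<alpha> = cinner (A proj_one) proj_one / s" and "\<beta> = cinner (B proj_one) proj_one / s"
  \<comment> \<open>Evaluating \<open>A (B (A proj_one))\<close> and its mirror image in both
    bracketings shows that \<open>proj_one\<close> is an eigenvector of \<open>A\<close> and of
    \<open>B\<close>.\<close>
  have "s \<cdot> A proj_one = A (B (A proj_one))" "s \<cdot> B proj_one = B (A (B proj_one))"
    by (simp_all add: AB(2)[OF proj_one_in] AB(1)[OF proj_one_in] lin s_def)
  then have "s \<cdot> A proj_one = cinner (A proj_one) proj_one \<cdot> proj_one" "s \<cdot> B proj_one = cinner (B proj_one) proj_one \<cdot> proj_one"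
    unfolding AB(1)[OF in_S(1)] AB(2)[OF in_S(2)] by simp_all
  then have "s \<cdot> A proj_one = (s * \<alpha>) \<cdot> proj_one" "s \<cdot> B proj_one = (s * \<beta>) \<cdot> proj_one"
    using s by (simp_all add: \<alpha>_def \<beta>_def)
  then have ev: "A proj_one = \<alpha> \<cdot> proj_one" "B proj_one = \<beta> \<cdot> proj_one"
    using s by (simp_all flip: ell2.scale_scale)
  \<comment> \<open>Applying \<open>A\<close> after \<open>B\<close> to \<open>proj_one\<close>
    fixes the product of the two eigenvalues.\<close>
  have "s \<cdot> proj_one = (\<beta> * \<alpha>) \<cdot> proj_one"
    using AB(1)[OF proj_one_in, symmetric] by (simp add: ev lin s_def)
  then have ab: "\<beta> * \<alpha> = s"
    using False by (metis ell2.scale_right_imp_eq)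
  \<comment> \<open>\<open>\<beta>\<close> leaves the second argument of \<open>cinner\<close>
    conjugated; it is real because \<open>B\<close> is self-adjoint.\<close>
  have "cnj \<beta> = \<beta>"
    using s by (simp add: \<beta>_def cnj_cinner) (simp add: B_def cinner_defect)
  have XY: "X proj_one \<in> S" "Y proj_one \<in> S" using word_in X Y by auto
  have "s * cinner (X proj_one) (Y proj_one) = cinner (X (A proj_one)) (Y (B proj_one))"
    by (simp add: ev word_cscl[OF X] word_cscl[OF Y] \<open>cnj \<beta> = \<beta>\<close> flip: ab)
  also have "\<dots> = cinner (A (X proj_one)) (B (Y proj_one))"
    unfolding defs using word_commute_defect[OF X proj_one_in] word_commute_defect[OF Y proj_one_in] by simp
  also have "\<dots> = cinner (B (A (X proj_one))) (Y proj_one)"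
    using XY in_S unfolding B_def by (simp add: cinner_defect)
  also have "\<dots> = cinner (X proj_one) proj_one * cinner proj_one (Y proj_one)"
    using AB(2)[OF XY(1)] by simp
  finally show ?thesis by (simp add: s_def)
qed

lemma proj_ebasis_inc: "eproj S (ebasis (inc i k)) = cshift i (eproj S (ebasis k))"
  by (simp add: cshift_proj sh_ebasis)

text \<open>One variable of nonzero exponent is peeled off at a time. \<open>T\<close> is uniform in
  \<open>m\<close> because \<open>gram_split\<close> applies it both to the constant monomial and on
  top of another monomial.\<close>

lemma word_monomial:
  fixes k :: "'n \<Rightarrow> nat"
  assumes "\<And>j. j \<notin> F \<Longrightarrow> k j = 0"
  shows "\<exists>T T'. word F T T' \<and> (\<forall>m. eproj S (ebasis (\<lambda>j. m j + k j)) = T (eproj S (ebasis m)))"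
  using assms
proof (induction "sum k UNIV" arbitrary: k)
  case 0
  then have "k = (\<lambda>_. 0)" by (auto simp: fun_eq_iff)
  then show ?case by (auto intro!: exI[of _ "\<lambda>x. x"] word_id)
next
  case (Suc n)
  have "sum k UNIV \<noteq> 0" using Suc.hyps(2) by linarith
  then obtain j where j: "k j \<noteq> 0" by (meson sum.neutral)
  have "sum k UNIV = k j + sum k (UNIV-{j})" by (simp add: sum.remove)
  moreover have "sum (dec j k) UNIV = (k j - 1) + sum k (UNIV-{j})"
    by (simp add: sum.remove[of _ j])
  ultimately have "n = sum (dec j k) UNIV" using Suc.hyps(2) j by linarith
  moreover have "dec j k l = 0" if "l \<notin> F" for l using Suc.prems[OF that] by auto
  ultimately obtain T T' where T: "word F T T'"
      "\<And>m. eproj S (ebasis (\<lambda>l. m l + dec j k l)) = T (eproj S (ebasis m))"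
    using Suc.hyps(1)[of "dec j k"] by blast
  have "(\<lambda>l. m l + k l) = inc j (\<lambda>l. m l + dec j k l)" for m
    using j by (auto simp: fun_eq_iff)
  then have "\<forall>m. eproj S (ebasis (\<lambda>l. m l + k l)) = cshift j (T (eproj S (ebasis m)))"
    by (simp only: proj_ebasis_inc T(2)) simp
  moreover have "j \<in> F" using Suc.prems[of j] j by blast
  ultimately show ?case using word_cshift[OF T(1)] by blast
qed

section \<open>The matrix of the projection in the monomial basis\<close>

definition gram :: "('n \<Rightarrow> nat) \<Rightarrow> ('n \<Rightarrow> nat) \<Rightarrow> complex" where
  "gram k l = cinner (eproj S (ebasis k)) (eproj S (ebasis l))"

definition single :: "'n \<Rightarrow> nat \<Rightarrow> 'n \<Rightarrow> nat" where
  "single i a = (\<lambda>j. if j = i then a else 0)"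

lemma single_0: "single i 0 = (\<lambda>_. 0)"
  by (auto simp: single_def)

lemma gram_coef: "gram k l = coef (eproj S (ebasis k)) l"
  by (simp add: gram_def cinner_eproj_right[OF closed])

lemma gram_0: "gram (\<lambda>_. 0) (\<lambda>_. 0) = cinner proj_one proj_one"
  by (simp add: gram_def proj_one_def)

text \<open>For \<open>k\<close>, the word \<open>X\<close> builds the power of variable
  \<open>i\<close> and \<open>Y\<close> the rest; \<open>V\<close> and \<open>W\<close> do the same
  for \<open>l\<close>. Collecting the words in \<open>i\<close> in the first argument and the
  others in the second gives the shape of \<open>cinner_word_proj_one\<close>; undoing this in each
  factor leaves two Gram entries.\<close>

lemma gram_split:
  "cinner proj_one proj_one * gram k l =
     gram (single i (k i)) (single i (l i)) * gram (k(i := 0)) (l(i := 0))"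
proof -
  have "\<exists>X X' Y Y'. word {i} X X' \<and> word (-{i}) Y Y' \<and>
      eproj S (ebasis (single i (k i))) = X proj_one \<and> eproj S (ebasis (k(i := 0))) = Y proj_one \<and>
      eproj S (ebasis k) = Y (X proj_one)" for k
  proof -
    obtain X X' where X: "word {i} X X'"
        "\<And>m. eproj S (ebasis (\<lambda>j. m j + single i (k i) j)) = X (eproj S (ebasis m))"
      using word_monomial[of "{i}" "single i (k i)"] by (auto simp: single_def)
    obtain Y Y' where Y: "word (-{i}) Y Y'"
        "\<And>m. eproj S (ebasis (\<lambda>j. m j + (k(i := 0)) j)) = Y (eproj S (ebasis m))"
      using word_monomial[of "-{i}" "k(i := 0)"] by auto
    have 1: "(\<lambda>j. single i (k i) j + (k(i := 0)) j) = k" by (auto simp: single_def)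
    have "eproj S (ebasis (single i (k i))) = X proj_one"
      using X(2)[of "\<lambda>_. 0"] by (simp add: proj_one_def)
    moreover have "eproj S (ebasis (k(i := 0))) = Y proj_one"
      using Y(2)[of "\<lambda>_. 0"] by (simp add: proj_one_def del: fun_upd_apply)
    moreover have "eproj S (ebasis k) = Y (eproj S (ebasis (single i (k i))))"
      using Y(2)[of "single i (k i)"] by (simp only: 1)
    ultimately show ?thesis using X(1) Y(1) by metis
  qed
  note * = this
  obtain X X' Y Y' where k: "word {i} X X'" "word (-{i}) Y Y'"
      "eproj S (ebasis (single i (k i))) = X proj_one" "eproj S (ebasis (k(i := 0))) = Y proj_one"
      "eproj S (ebasis k) = Y (X proj_one)"
    using *[of k] by blast
  obtain V V' W W' where l: "word {i} V V'" "word (-{i}) W W'"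
      "eproj S (ebasis (single i (l i))) = V proj_one" "eproj S (ebasis (l(i := 0))) = W proj_one"
      "eproj S (ebasis l) = W (V proj_one)"
    using *[of l] by blast
  have in_S: "X proj_one \<in> S" "Y proj_one \<in> S" "V proj_one \<in> S" "W proj_one \<in> S"
    "Y (X proj_one) \<in> S" "V' (X proj_one) \<in> S" "Y' (W proj_one) \<in> S"
    using word_in k l proj_one_in by metis+
  have "gram k l = cinner (Y (X proj_one)) (V (W proj_one))"
    using word_commute_word[OF l(1,2) proj_one_in] by (simp add: gram_def k(5) l(5))
  also have "\<dots> = cinner (V' (Y (X proj_one))) (W proj_one)"
    using word_adjoint[OF word_swap[OF l(1)]] in_S by simp
  also have "V' (Y (X proj_one)) = Y (V' (X proj_one))"
    using word_commute_word[OF k(2) word_swap[OF l(1)] in_S(1)] by auto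
  also have "cinner (Y (V' (X proj_one))) (W proj_one) = cinner (V' (X proj_one)) (Y' (W proj_one))"
    using word_adjoint[OF k(2)] in_S by simp
  \<comment> \<open>\<open>V'\<close> after \<open>X\<close> is a word over \<open>{i}\<close>, and
    \<open>Y'\<close> after \<open>W\<close> is a word over the complement.\<close>
  finally have "cinner proj_one proj_one * gram k l = cinner (V' (X proj_one)) proj_one * cinner proj_one (Y' (W proj_one))"
    using cinner_word_proj_one[OF word_compose[OF word_swap[OF l(1)] k(1)] word_compose[OF word_swap[OF k(2)] l(2)]]
    by simp
  also have "cinner (V' (X proj_one)) proj_one = cinner (X proj_one) (V proj_one)"
    using word_adjoint[OF word_swap[OF l(1)]] in_S by simp
  also have "cinner proj_one (Y' (W proj_one)) = cinner (Y proj_one) (W proj_one)"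
    using word_adjoint[OF k(2)] in_S by simp
  finally show ?thesis by (simp add: gram_def k l)
qed

text \<open>Each variable split off by \<open>gram_split\<close> costs one factor
  \<open>cinner proj_one proj_one\<close>. The single factor on the right comes from the empty set,
  where the Gram entry is that number itself.\<close>

lemma gram_prod_aux:
  "cinner proj_one proj_one ^ card F * gram (\<lambda>j. if j \<in> F then k j else 0) (\<lambda>j. if j \<in> F then l j else 0) =
     cinner proj_one proj_one * (\<Prod>i\<in>F. gram (single i (k i)) (single i (l i)))"
proof -
  have "finite F" by simp
  then show ?thesis
  proof (induction F rule: finite_induct)
    case empty
    then show ?case by (simp add: gram_0)
  next
    case (insert i F)
    define r where "r F k = (\<lambda>j. if j \<in> F then k j else (0 :: nat))" for F :: "'n set" and k
    have r: "r (insert i F) k i = k i" "(r (insert i F) k)(i := 0) = r F k" for k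
      using insert.hyps by (auto simp: r_def)
    have "cinner proj_one proj_one ^ card (insert i F) * gram (r (insert i F) k) (r (insert i F) l) =
        cinner proj_one proj_one ^ card F * (cinner proj_one proj_one * gram (r (insert i F) k) (r (insert i F) l))"
      using insert.hyps by simp
    also have "\<dots> = gram (single i (k i)) (single i (l i)) * (cinner proj_one proj_one ^ card F * gram (r F k) (r F l))"
      by (subst gram_split[of _ _ i]) (simp add: r)
    also have "\<dots> = cinner proj_one proj_one * (\<Prod>i\<in>insert i F. gram (single i (k i)) (single i (l i)))"
      using insert unfolding r_def by simp
    finally show ?case unfolding r_def .
  qed
qed

lemma gram_prod:
  "cinner proj_one proj_one ^ CARD('n) * gram k l =
     cinner proj_one proj_one * (\<Prod>i\<in>UNIV. gram (single i (k i)) (single i (l i)))"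
  using gram_prod_aux[of UNIV k l] by simp

lemma cinner_proj_ebasis: "x \<in> S \<Longrightarrow> cinner x (eproj S (ebasis k)) = coef x k"
  by (simp add: cinner_eproj_right[OF closed])

text \<open>Every projected monomial is a word applied to \<open>proj_one\<close>, and the
  coefficients of a vector in \<open>S\<close> are its inner products with the projected
  monomials.\<close>

lemma proj_one_zero: "proj_one = 0 \<Longrightarrow> S = {0}"
proof -
  assume "proj_one = 0"
  have "x = 0" if "x \<in> S" for x
  proof (rule ell2_eqI)
    fix k
    obtain T T' where T: "word UNIV T T'"
        "\<And>m. eproj S (ebasis (\<lambda>j. m j + k j)) = T (eproj S (ebasis m))"
      using word_monomial[of UNIV k] by auto
    have "eproj S (ebasis k) = T proj_one"
      using T(2)[of "\<lambda>_. 0"] by (simp add: proj_one_def)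
    also have "\<dots> = 0"
      using word_cscl[OF T(1), of 0 proj_one] \<open>proj_one = 0\<close> by simp
    finally show "coef x k = coef 0 k"
      using cinner_proj_ebasis[OF that, of k] by simp
  qed
  then show "S = {0}" using S_simps by blast
qed

lemma inj_single: "inj (\<lambda>m :: 1 \<Rightarrow> nat. single i (m 1))"
proof (rule injI)
  fix m m' :: "1 \<Rightarrow> nat" assume "single i (m 1) = single i (m' 1)"
  then have "m 1 = m' 1" by (metis single_def)
  then show "m = m'" by (auto simp: fun_eq_iff)
qed

section \<open>Tensor factors from restrictions to the coordinate axes\<close>

lift_definition axis :: "'n \<Rightarrow> ('n \<Rightarrow> nat) ell2 \<Rightarrow> (1 \<Rightarrow> nat) ell2"
  is "\<lambda>i f m. f (single i (m 1))"
  by (rule square_summable_inj[OF _ inj_single])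

definition factor :: "'n \<Rightarrow> nat \<Rightarrow> (1 \<Rightarrow> nat) ell2" where
  "factor i a = axis i (eproj S (ebasis (single i a)))"

lemma coef_factor: "coef (factor i a) (\<lambda>_. b) = gram (single i a) (single i b)"
  by (simp add: factor_def axis.rep_eq gram_coef)

text \<open>As a preimage of \<open>S\<close> under a bounded map that intertwines the backward
  shifts, this inherits closedness and invariance from \<open>S\<close>. The fixed entries
  \<open>factor j 0\<close> are the axis restrictions of \<open>proj_one\<close>.\<close>

definition tensor_factor :: "'n \<Rightarrow> (1 \<Rightarrow> nat) ell2 set" where
  "tensor_factor i = {f. tens ((\<lambda>j. factor j 0)(i := f)) \<in> S}"

lemma closed_tensor_factor: "closed_csubspace (tensor_factor i)"
  using closed_csubspace_vimage[OF bounded_clinear_tens_upd closed]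
  by (simp add: tensor_factor_def vimage_def)

lemma bs_tensor_factor: "f \<in> tensor_factor i \<Longrightarrow> bs j f \<in> tensor_factor i"
proof -
  assume "f \<in> tensor_factor i"
  then have "bs i (tens ((\<lambda>j. factor j 0)(i := f))) \<in> S"
    unfolding tensor_factor_def by (intro bs_in) auto
  then have "bs 1 f \<in> tensor_factor i" by (simp add: bs_tens tensor_factor_def)
  moreover have "j = 1" by simp
  ultimately show ?thesis by (simp only:)
qed

text \<open>Up to the scalar \<open>c\<close>, tensors of the vectors \<open>factor i (k i)\<close>
  are the projected monomials, whose span is dense in \<open>S\<close>; this gives one inclusion.
  The same vectors represent the coefficient functionals on the tensor factors, so the projection
  fixes every tensor with entries there, which gives the other.\<close>

lemma tensor_decomposition:
  assumes "proj_one \<noteq> 0"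
  shows "S = closure (ell2.span {tens f | f. \<forall>i. f i \<in> tensor_factor i})"
proof -
  define s where "s = cinner proj_one proj_one"
  \<comment> \<open>The surplus power of \<open>s\<close> in \<open>gram_prod\<close>, namely
    \<open>s ^ (CARD('n) - 1)\<close>.\<close>
  define c where "c = s ^ CARD('n) / s"
  have s: "s \<noteq> 0" "cnj s = s" using assms by (auto simp: s_def cnj_cinner)
  then have c: "c \<noteq> 0" "cnj c = c" "c * s = s ^ CARD('n)" by (auto simp: c_def)
  have card: "s ^ (CARD('n) - Suc 0) = c"
    using s by (simp add: c_def power_diff)
  have tens_factor: "tens (\<lambda>i. factor i (k i)) = c \<cdot> eproj S (ebasis k)" for k
  proof (rule ell2_eqI)
    fix l
    have "s * coef (tens (\<lambda>i. factor i (k i))) l = s * (c * gram k l)"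
      using gram_prod[of k l] s by (simp add: coef_tens coef_factor c_def s_def)
    then show "coef (tens (\<lambda>i. factor i (k i))) l = coef (c \<cdot> eproj S (ebasis k)) l"
      using s by (simp add: gram_coef)
  qed
  \<comment> \<open>Placing \<open>factor i a\<close> in slot \<open>i\<close> produces the tensor
    of the multi-index \<open>single i a\<close>, which \<open>tens_factor\<close> puts into
    \<open>S\<close>.\<close>
  have upd: "(\<lambda>j. factor j 0)(i := factor i a) = (\<lambda>j. factor j (single i a j))" for i a
    by (auto simp: fun_eq_iff single_def)
  have factor_in: "factor i a \<in> tensor_factor i" for i a
    by (simp add: tensor_factor_def upd tens_factor S_simps)
  define N where "N i = cinner (factor i 0) (factor i 0)" for i
  \<comment> \<open>This product is the squared norm of \<open>c \<cdot> proj_one\<close>.\<close>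
  have prod_N: "(\<Prod>i\<in>UNIV. N i) = c * c * s"
  proof -
    have "(\<Prod>i\<in>UNIV. N i) = cinner (tens (\<lambda>i. factor i 0)) (tens (\<lambda>i. factor i 0))"
      by (simp add: cinner_tens N_def)
    then show ?thesis
      using tens_factor[of "\<lambda>_. 0"] c by (simp add: s_def proj_one_def)
  qed
  \<comment> \<open>Up to the scalar \<open>N i / s\<close>, pairing with \<open>factor i b\<close>
    reads off coefficient \<open>b\<close>. The pairing of \<open>?x\<close> with a projected
    monomial is computed once as a coefficient and once slot by slot.\<close>
  have repro: "s * cinner f (factor i b) = N i * coef f (\<lambda>_. b)" if "f \<in> tensor_factor i" for f i b
  proof -
    let ?x = "tens ((\<lambda>j. factor j 0)(i := f))"
    have x: "?x \<in> S" using that by (simp add: tensor_factor_def)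
    have "coef ?x (single i b) = coef f (\<lambda>_. b) * (\<Prod>j\<in>UNIV-{i}. s)"
      unfolding coef_tens_upd
      by (intro arg_cong2[of _ _ _ _ "(*)"] prod.cong)
         (auto simp: single_def[of i] coef_factor single_0 gram_0 s_def)
    also have "\<dots> = c * coef f (\<lambda>_. b)" by (simp add: card)
    finally have "c * (c * coef f (\<lambda>_. b)) = c * coef ?x (single i b)" by simp
    also have "\<dots> = cinner ?x (c \<cdot> eproj S (ebasis (single i b)))"
      by (simp add: cinner_proj_ebasis[OF x] c)
    also have "\<dots> = cinner f (factor i b) * (\<Prod>j\<in>UNIV-{i}. N j)"
      unfolding tens_factor[symmetric] cinner_tens_upd
      by (intro arg_cong2[of _ _ _ _ "(*)"] prod.cong) (auto simp: single_def N_def)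
    \<comment> \<open>Multiplying by \<open>N i\<close> completes the product over the other slots,
      so that \<open>prod_N\<close> applies.\<close>
    finally have "N i * (c * (c * coef f (\<lambda>_. b))) = cinner f (factor i b) * (\<Prod>j\<in>UNIV. N j)"
      by (simp add: prod.remove[of UNIV i N])
    then have "(c * c) * (N i * coef f (\<lambda>_. b)) = (c * c) * (s * cinner f (factor i b))"
      by (simp add: prod_N mult_ac)
    then show ?thesis using c by simp
  qed
  have tens_in: "tens f \<in> S" if f: "\<And>i. f i \<in> tensor_factor i" for f
  proof -
    have "eproj S (tens f) = tens f"
    proof (rule ell2_eqI)
      fix l
      have "coef (eproj S (tens f)) l = cinner (eproj S (tens f)) (eproj S (ebasis l))"
        by (simp add: cinner_proj_ebasis)
      also have "\<dots> = cinner (tens f) (eproj S (ebasis l))"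
        by (rule cinner_eproj_left[OF closed proj_in])
      finally have "c * coef (eproj S (tens f)) l = cinner (tens f) (c \<cdot> eproj S (ebasis l))"
        by (simp add: c)
      also have "\<dots> = (\<Prod>i\<in>UNIV. cinner (f i) (factor i (l i)))"
        by (simp add: cinner_tens flip: tens_factor)
      \<comment> \<open>Since \<open>c * s = s ^ CARD('n)\<close>, every slot receives the factor
        \<open>s\<close> that \<open>repro\<close> requires.\<close>
      finally have "c * s * (c * coef (eproj S (tens f)) l) =
          (\<Prod>i\<in>UNIV. s * cinner (f i) (factor i (l i)))"
        by (simp add: prod.distrib c)
      also have "\<dots> = c * s * (c * coef (tens f) l)"
        by (simp add: repro[OF f] prod.distrib prod_N coef_tens)
      finally show "coef (eproj S (tens f)) l = coef (tens f) l"
        using c s by simp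
    qed
    then show ?thesis by (metis proj_in)
  qed
  define T where "T = closure (ell2.span {tens f | f. \<forall>i. f i \<in> tensor_factor i})"
  have T: "closed_csubspace T"
    unfolding T_def by (intro closed_csubspace_closure ell2.subspace_span)
  have "T \<subseteq> S"
    unfolding T_def by (rule closure_span_subset[OF closed]) (auto intro: tens_in)
  have tens_T: "tens (\<lambda>i. factor i (k i)) \<in> T" for k
    unfolding T_def using factor_in by (intro subsetD[OF closure_subset] ell2.span_base) auto
  have "(1 / c) \<cdot> (c \<cdot> eproj S (ebasis k)) \<in> T" for k
    using closed_csubspaceD(3)[OF T tens_T[of k], of "1 / c"] by (simp only: tens_factor)
  then have mono_T: "eproj S (ebasis k) \<in> T" for k using c by simp
  have "x \<in> T" if "x \<in> S" for x
  proof -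
    \<comment> \<open>The residual lies in \<open>S\<close> and is orthogonal to \<open>T\<close>,
      hence to all projected monomials; these inner products are its coefficients.\<close>
    have "x - eproj T x \<in> S"
      using that eproj_in[OF T] \<open>T \<subseteq> S\<close> S_simps(4) by blast
    then have "coef (x - eproj T x) k = 0" for k
      using eproj_works[OF T, of x] mono_T[of k] cinner_proj_ebasis by metis
    then have "x - eproj T x = 0" by (intro ell2_eqI) (simp del: minus_ell2.rep_eq)
    then show ?thesis using eproj_in[OF T, of x] by simp
  qed
  with \<open>T \<subseteq> S\<close> show ?thesis unfolding T_def by blast
qed

end

section \<open>The two directions for coefficient spaces\<close>

lemma zero_tensor_decomposition:
  "closure (ell2.span {tens f | f :: 'n::finite \<Rightarrow> _. \<forall>i. f i \<in> {0}}) = {0}"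
proof -
  \<comment> \<open>The index type is nonempty, so each coefficient is a product with a zero
    factor.\<close>
  have "tens f = 0" if "\<forall>i. f i = 0" for f :: "'n \<Rightarrow> _"
    by (rule ell2_eqI) (simp add: coef_tens that)
  then have "{tens f | f :: 'n \<Rightarrow> _. \<forall>i. f i \<in> {0}} \<subseteq> {0}" by auto
  then have "ell2.span {tens f | f :: 'n \<Rightarrow> _. \<forall>i. f i \<in> {0}} \<subseteq> {0}"
    by (rule ell2.span_minimal) (simp add: ell2.subspace_def)
  then have "ell2.span {tens f | f :: 'n \<Rightarrow> _. \<forall>i. f i \<in> {0}} = {0}"
    using ell2.span_zero by blast
  then show ?thesis by simp
qed

lemma (in backward_invariant) tensor_decomposition_exists:
  assumes "\<And>i j x. i \<noteq> j \<Longrightarrow> x \<in> S \<Longrightarrow> eproj S (sh i (bs j x)) = bs j (eproj S (sh i x))"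
  shows "\<exists>R. (\<forall>i. backward_invariant (R i)) \<and>
    S = closure (ell2.span {tens f | f. \<forall>i. f i \<in> R i})"
proof -
  interpret doubly_commuting_module S
    by unfold_locales (simp add: cshift_def assms)
  show ?thesis
  proof (cases "proj_one = 0")
    \<comment> \<open>The construction divides by the squared norm of \<open>proj_one\<close>; in
      this case \<open>S\<close> is zero and zero factors serve.\<close>
    case True
    have "backward_invariant {0 :: (1 \<Rightarrow> nat) ell2}"
      by (simp add: backward_invariant_def closed_csubspace_def ell2.subspace_def
          bounded_clinear_zero[OF bounded_clinear_bs])
    moreover have "S = closure (ell2.span {tens f | f. \<forall>i. f i \<in> {0}})"
      using proj_one_zero[OF True] by (simp only: zero_tensor_decomposition)
    ultimately show ?thesis by (intro exI[of _ "\<lambda>_. {0}"]) blast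
  next
    case False
    have "backward_invariant (tensor_factor i)" for i
      by (simp add: backward_invariant_def closed_tensor_factor bs_tensor_factor)
    with tensor_decomposition[OF False] show ?thesis by blast
  qed
qed

text \<open>On elementary tensors the left and right sides differ only in the order of operations on
  the separate slots \<open>i\<close> and \<open>j\<close>; both are bounded operators, so equality
  extends to the closed span.\<close>

lemma tensor_doubly_commuting:
  fixes R :: "'n::finite \<Rightarrow> (1 \<Rightarrow> nat) ell2 set"
  assumes R: "\<And>i. closed_csubspace (R i)" and inv: "\<And>i f. f \<in> R i \<Longrightarrow> bs 1 f \<in> R i"
    and S: "S = closure (ell2.span {tens f | f. \<forall>i. f i \<in> R i})"
    and ij: "i \<noteq> j" and x: "x \<in> S"
  shows "eproj S (sh i (bs j x)) = bs j (eproj S (sh i x))"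
proof -
  have cl: "closed_csubspace S"
    unfolding S by (intro closed_csubspace_closure ell2.subspace_span)
  have tens_in: "tens f \<in> S" if "\<And>i. f i \<in> R i" for f
    unfolding S using that by (intro subsetD[OF closure_subset] ell2.span_base) auto
  \<comment> \<open>Only slot \<open>k\<close> may hold a vector outside its factor, so
    orthogonality to the generating tensors reduces to orthogonality in that slot.\<close>
  have proj: "eproj S (tens (f(k := y))) = tens (f(k := eproj (R k) y))"
    if f: "\<And>i. f i \<in> R i" for f y k
  proof (rule eproj_eqI[OF cl])
    show "tens (f(k := eproj (R k) y)) \<in> S"
      by (rule tens_in) (simp add: f eproj_in[OF R])
    fix h assume "h \<in> S"
    let ?d = "tens (f(k := eproj (R k) y)) - tens (f(k := y))"
    have "S \<subseteq> {h. \<forall>z\<in>{?d}. cinner h z = 0}"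
      unfolding S
    proof (rule closure_span_subset[OF closed_csubspace_orthogonal], safe)
      fix g :: "'n \<Rightarrow> _" assume "\<forall>i. g i \<in> R i"
      then have "cinner ?d (tens g) = 0"
        by (simp add: cinner_diff_left cinner_tens_upd cinner_eproj_left[OF R])
      then show "cinner (tens g) ?d = 0" by (metis cnj_cinner complex_cnj_zero)
    qed
    with \<open>h \<in> S\<close> have "cinner h ?d = 0" by blast
    then have "cinner ?d h = 0" by (metis cnj_cinner complex_cnj_zero)
    then show "cinner (tens (f(k := eproj (R k) y))) h = cinner (tens (f(k := y))) h"
      by (simp add: cinner_diff_left)
  qed
  have "S \<subseteq> {x. eproj S (sh i (bs j x)) = bs j (eproj S (sh i x))}"
    unfolding S[symmetric]
  proof (subst S, rule closure_span_subset, rule closed_csubspace_equaliser)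
    show "bounded_clinear (\<lambda>x. eproj S (sh i (bs j x)))"
      by (rule bounded_clinear_compose[OF bounded_clinear_eproj[OF cl]
            bounded_clinear_compose[OF bounded_clinear_sh bounded_clinear_bs]])
    show "bounded_clinear (\<lambda>x. bs j (eproj S (sh i x)))"
      by (rule bounded_clinear_compose[OF bounded_clinear_bs
            bounded_clinear_compose[OF bounded_clinear_eproj[OF cl] bounded_clinear_sh]])
    show "{tens f | f. \<forall>i. f i \<in> R i} \<subseteq> {x. eproj S (sh i (bs j x)) = bs j (eproj S (sh i x))}"
    proof safe
      fix f assume f: "\<forall>i. f i \<in> R i"
      then have "\<And>k. (f(j := bs 1 (f j))) k \<in> R k" by (simp add: inv)
      from proj[of "f(j := bs 1 (f j))" i "sh 1 (f i)", OF this] ij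
      have "eproj S (sh i (bs j (tens f))) = tens ((f(j := bs 1 (f j)))(i := eproj (R i) (sh 1 (f i))))"
        by (simp add: bs_tens sh_tens)
      also have "\<dots> = bs j (tens (f(i := eproj (R i) (sh 1 (f i)))))"
        using ij by (simp add: bs_tens fun_upd_twist)
      also have "\<dots> = bs j (eproj S (sh i (tens f)))"
        using f by (simp add: sh_tens proj)
      finally show "eproj S (sh i (bs j (tens f))) = bs j (eproj S (sh i (tens f)))" .
    qed
  qed
  with x show ?thesis by blast
qed

section \<open>Transfer to the Hardy space\<close>

lemma power_series_zero_1:
  fixes g :: "nat \<Rightarrow> complex"
  assumes "\<And>w. norm w < 1 \<Longrightarrow> ((\<lambda>m. g m * w ^ m) has_sum 0) UNIV"
  shows "g m = 0"
proof -
  have sums: "(\<lambda>m. g m * w ^ m) sums 0" if "norm w < 1" for w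
    using assms[OF that] by (rule has_sum_imp_sums)
  \<comment> \<open>Convergence at one nonzero point gives the positive radius required by the
    identity theorem.\<close>
  have "conv_radius g \<ge> norm (1 / 2 :: complex)"
    by (rule conv_radius_geI) (use sums[of "1 / 2"] in \<open>auto dest: sums_summable\<close>)
  then have "fps_conv_radius (Abs_fps g) > 0"
    by (auto simp: fps_conv_radius_def intro: less_le_trans[rotated])
  moreover have "\<forall>\<^sub>F w in nhds 0. eval_fps (Abs_fps g) w = eval_fps 0 w"
  proof (rule eventually_mono)
    show "\<forall>\<^sub>F w :: complex in nhds 0. w \<in> ball 0 1"
      by (rule eventually_nhds_in_open) auto
    fix w :: complex assume "w \<in> ball 0 1"
    with sums[of w] show "eval_fps (Abs_fps g) w = eval_fps 0 w"
      by (simp add: eval_fps_def sums_iff)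
  qed
  ultimately have "Abs_fps g = 0"
    by (intro eval_fps_eqD) auto
  then show ?thesis by (simp add: fps_eq_iff)
qed

text \<open>Coefficients are extracted one variable at a time: the exponents on \<open>F\<close> are
  already fixed, the remaining variables are still free. For \<open>F = UNIV\<close> a single
  coefficient is left.\<close>

lemma power_series_zero_partial:
  fixes a :: "('n::finite \<Rightarrow> nat) \<Rightarrow> complex"
  assumes a: "\<And>z. z \<in> polydisc \<Longrightarrow> ((\<lambda>k. a k * (\<Prod>i\<in>UNIV. (z $ i) ^ k i)) has_sum 0) UNIV"
    and z: "z \<in> polydisc"
  shows "((\<lambda>k. a k * (\<Prod>i\<in>-F. (z $ i) ^ k i)) has_sum 0) {k. \<forall>i\<in>F. k i = \<kappa> i}"
proof -
  have "finite F" by simp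
  then show ?thesis
    using z
  proof (induction F arbitrary: z rule: finite_induct)
    case empty
    then show ?case using a by simp
  next
    case (insert j F)
    define B where "B = {k. \<forall>i\<in>F. k i = \<kappa> i}"
    define Bm where "Bm m = {k \<in> B. k j = m}" for m
    define c where "c k = a k * (\<Prod>i\<in>-insert j F. (z $ i) ^ k i)" for k
    have split: "-F = insert j (-insert j F)" using insert.hyps by auto
    \<comment> \<open>Letting the j-th coordinate vary as \<open>w\<close> and grouping by its
      exponent yields a power series in \<open>w\<close> with coefficients
      \<open>infsum c (Bm m)\<close>.\<close>
    have IH: "((\<lambda>k. c k * w ^ k j) has_sum 0) B" if "norm w < 1" for w
    proof -
      define z' where "z' = (\<chi> i. if i = j then w else z $ i)"
      have "z' \<in> polydisc"
        using insert.prems that by (auto simp: polydisc_def z'_def)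
      note insert.IH[OF this]
      moreover have "a k * (\<Prod>i\<in>-F. (z' $ i) ^ k i) = c k * w ^ k j" for k
        unfolding split c_def by (subst prod.insert) (auto simp: z'_def intro!: prod.cong)
      ultimately show ?thesis by (simp add: B_def)
    qed
    have bij: "bij_betw snd (Sigma UNIV Bm) B"
      by (rule bij_betwI[where g = "\<lambda>k. (k j, k)"]) (auto simp: Bm_def)
    have "c summable_on Bm m" for m
    proof -
      \<comment> \<open>On \<open>Bm m\<close> the weight is the nonzero constant
        \<open>(1 / 2) ^ m\<close>, which can be divided out.\<close>
      have "(\<lambda>k. c k * (1 / 2) ^ k j) summable_on B"
        using IH[of "1 / 2"] by (auto simp: summable_on_def)
      then have "(\<lambda>k. c k * (1 / 2) ^ k j) summable_on Bm m"
        by (rule summable_on_subset_banach) (auto simp: Bm_def)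
      then have "(\<lambda>k. c k * (1 / 2) ^ m) summable_on Bm m"
        by (rule summable_on_cong[THEN iffD1, rotated]) (auto simp: Bm_def)
      from summable_on_cmult_left[OF this, of "2 ^ m"] show ?thesis
        by (simp add: power_one_over)
    qed
    then have c_sum: "(c has_sum infsum c (Bm m)) (Bm m)" for m by simp
    have "infsum c (Bm m) = 0" for m
    proof (rule power_series_zero_1)
      fix w :: complex assume w: "norm w < 1"
      have "((\<lambda>p. c (snd p) * w ^ (snd p) j) has_sum 0) (Sigma UNIV Bm)"
        using IH[OF w] has_sum_reindex_bij_betw[OF bij, of "\<lambda>k. c k * w ^ k j"] by simp
      then show "((\<lambda>m. infsum c (Bm m) * w ^ m) has_sum 0) UNIV"
      proof (rule has_sum_SigmaD)
        fix m
        have "((\<lambda>k. c k * w ^ m) has_sum (infsum c (Bm m) * w ^ m)) (Bm m)"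
          by (rule has_sum_cmult_left[OF c_sum])
        then show "((\<lambda>k. c (snd (m, k)) * w ^ (snd (m, k)) j) has_sum (infsum c (Bm m) * w ^ m)) (Bm m)"
          by (rule has_sum_cong[THEN iffD1, rotated]) (auto simp: Bm_def)
      qed
    qed
    with c_sum[of "\<kappa> j"] have "(c has_sum 0) (Bm (\<kappa> j))" by simp
    moreover have "Bm (\<kappa> j) = {k. \<forall>i\<in>insert j F. k i = \<kappa> i}"
      by (auto simp: Bm_def B_def)
    ultimately show ?case unfolding c_def by simp
  qed
qed

lemma has_taylor_unique:
  assumes "has_taylor f a" "has_taylor f b"
  shows "a = b"
proof
  fix \<kappa>
  have "((\<lambda>k. (a k - b k) * (\<Prod>i\<in>UNIV. (z $ i) ^ k i)) has_sum 0) UNIV" if "z \<in> polydisc" for z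
  proof -
    let ?m = "\<lambda>k. \<Prod>i\<in>UNIV. (z $ i) ^ k i"
    have "((\<lambda>k. a k * ?m k) has_sum f z) UNIV" "((\<lambda>k. b k * ?m k) has_sum f z) UNIV"
      using assms that by (simp_all add: has_taylor_def)
    from has_sum_add[OF this(1) has_sum_uminusI[OF this(2)]]
    show ?thesis by (simp add: left_diff_distrib)
  qed
  moreover have "(0 :: complex ^ 'a) \<in> polydisc" by (simp add: polydisc_def)
  ultimately have "((\<lambda>k. (a k - b k) * (\<Prod>i\<in>-UNIV. (0 $ i) ^ k i)) has_sum 0) {k. \<forall>i\<in>UNIV. k i = \<kappa> i}"
    by (rule power_series_zero_partial)
  moreover have "{k. \<forall>i\<in>UNIV. k i = \<kappa> i} = {\<kappa>}" by auto
  ultimately have "((\<lambda>k. a k - b k) has_sum 0) {\<kappa>}" by simp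
  then have "(\<Sum>\<^sub>\<infinity>k\<in>{\<kappa>}. a k - b k) = 0" by (rule infsumI)
  then show "a \<kappa> = b \<kappa>" by simp
qed

lemma taylor_eqI: "has_taylor f a \<Longrightarrow> taylor f = a"
  unfolding taylor_def using has_taylor_unique by (intro the_equality) auto

section \<open>The passage from coefficients to functions\<close>

definition hfun :: "('n \<Rightarrow> nat) ell2 \<Rightarrow> complex ^ 'n \<Rightarrow> complex" where
  "hfun x z = (if z \<in> polydisc then \<Sum>\<^sub>\<infinity>k. coef x k * (\<Prod>i\<in>UNIV. (z $ i) ^ k i) else 0)"

text \<open>The squared moduli are products of geometric series. With
  \<open>square_summable_mult\<close> this makes the series of \<open>hfun\<close> absolutely
  convergent.\<close>

lemma square_summable_monomials:
  fixes z :: "complex ^ 'n::finite"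
  assumes "z \<in> polydisc"
  shows "square_summable (\<lambda>k. \<Prod>i\<in>UNIV. (z $ i) ^ k i)"
proof -
  have "(\<lambda>m. norm (((z $ i) ^ m)\<^sup>2)) summable_on UNIV" for i
  proof -
    have "norm ((norm (z $ i))\<^sup>2) < 1"
      using assms by (simp add: polydisc_def power_less_one_iff abs_square_less_1)
    then have "summable (\<lambda>m. ((norm (z $ i))\<^sup>2) ^ m)" by (rule summable_geometric)
    then show ?thesis
      by (subst summable_on_UNIV_nonneg_real_iff)
         (simp_all add: norm_power mult.commute flip: power_mult)
  qed
  from abs_summable_prod[OF this] show ?thesis
    by (simp add: square_summable_def norm_power prod_power_distrib[symmetric])
qed

lemma has_taylor_hfun: "has_taylor (hfun x) (coef x)"
  unfolding has_taylor_def
proof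
  fix z :: "complex ^ 'a" assume z: "z \<in> polydisc"
  have "(\<lambda>k. coef x k * (\<Prod>i\<in>UNIV. (z $ i) ^ k i)) summable_on UNIV"
    by (rule abs_summable_summable)
       (intro square_summable_mult square_summable_coef square_summable_monomials z)
  then show "((\<lambda>k. coef x k * (\<Prod>i\<in>UNIV. (z $ i) ^ k i)) has_sum hfun x z) UNIV"
    by (simp add: hfun_def z)
qed

lemma hfun_outside: "z \<notin> polydisc \<Longrightarrow> hfun x z = 0"
  by (simp add: hfun_def)

lemma hfun_eqI:
  assumes "has_taylor f (coef x)" "\<And>z. z \<notin> polydisc \<Longrightarrow> f z = 0"
  shows "f = hfun x"
proof
  fix z
  show "f z = hfun x z"
    using assms infsumI by (cases "z \<in> polydisc") (fastforce simp: hfun_def has_taylor_def)+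
qed

lemma taylor_hfun [simp]: "taylor (hfun x) = coef x"
  by (rule taylor_eqI[OF has_taylor_hfun])

lemma hfun_inject [simp]: "hfun x = hfun y \<longleftrightarrow> x = y"
  by (metis taylor_hfun coef_inject)

lemma hfun_image_eq_iff [simp]: "hfun ` S = hfun ` T \<longleftrightarrow> S = T"
  by (rule inj_image_eq_iff) (simp add: inj_def)

lemma hardy_eq: "hardy = range hfun"
proof (intro equalityI subsetI)
  fix f :: "complex ^ 'a \<Rightarrow> complex" assume "f \<in> hardy"
  then obtain a where a: "has_taylor f a" "square_summable a" "\<And>z. z \<notin> polydisc \<Longrightarrow> f z = 0"
    by (auto simp: hardy_def square_summable_def)
  then have "f = hfun (Abs_ell2 a)"
    by (intro hfun_eqI) (simp_all add: coef_Abs_ell2)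
  then show "f \<in> range hfun" by blast
next
  fix f :: "complex ^ 'a \<Rightarrow> complex" assume "f \<in> range hfun"
  then show "f \<in> hardy"
    using has_taylor_hfun square_summable_coef
    by (auto simp: hardy_def hfun_outside square_summable_def)
qed

lemma hardy_inner_hfun [simp]: "hardy_inner (hfun x) (hfun y) = cinner x y"
  by (simp add: hardy_inner_def cinner.rep_eq)

lemma hardy_norm_hfun [simp]: "hardy_norm (hfun x) = norm x"
  by (simp add: hardy_norm_def norm_ell2_def inner_ell2_def)

lemma hfun_add: "hfun (x + y) = hfun x + hfun y"
proof (rule hfun_eqI[symmetric])
  show "has_taylor (hfun x + hfun y) (coef (x + y))"
    using has_taylor_hfun[of x] has_taylor_hfun[of y]
    by (auto simp: has_taylor_def distrib_right intro!: has_sum_add)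
qed (simp add: hfun_outside)

lemma hfun_cscl: "hfun (c \<cdot> x) = cscale c (hfun x)"
proof (rule hfun_eqI[symmetric])
  show "has_taylor (cscale c (hfun x)) (coef (c \<cdot> x))"
    using has_taylor_hfun[of x]
    by (auto simp: has_taylor_def cscale_def mult.assoc intro!: has_sum_cmult_right)
qed (simp add: hfun_outside cscale_def)

global_interpretation hfun: Vector_Spaces.linear cscl cscale hfun
  by unfold_locales (simp_all add: hfun_add hfun_cscl)

text \<open>Multiplication by the coordinate reindexes the series along \<open>inc i\<close>, and
  the coefficients of \<open>sh i x\<close> vanish off the range of \<open>inc i\<close>.\<close>

lemma mult_coord_hfun: "mult_coord i (hfun x) = hfun (sh i x)"
proof (rule hfun_eqI)
  show "has_taylor (mult_coord i (hfun x)) (coef (sh i x))"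
    unfolding has_taylor_def
  proof
    fix z :: "complex ^ 'a" assume z: "z \<in> polydisc"
    have "((\<lambda>k. z $ i * (coef x k * (\<Prod>j\<in>UNIV. (z $ j) ^ k j))) has_sum mult_coord i (hfun x) z) UNIV"
      unfolding mult_coord_def using has_taylor_hfun[of x] z
      by (intro has_sum_cmult_right) (auto simp: has_taylor_def)
    moreover have "z $ i * (coef x k * (\<Prod>j\<in>UNIV. (z $ j) ^ k j)) =
        coef (sh i x) (inc i k) * (\<Prod>j\<in>UNIV. (z $ j) ^ inc i k j)" for k
    proof -
      have "(\<Prod>j\<in>UNIV - {i}. (z $ j) ^ inc i k j) = (\<Prod>j\<in>UNIV - {i}. (z $ j) ^ k j)"
        by (rule prod.cong) auto
      then show ?thesis by (simp add: prod.remove[of UNIV i] mult_ac)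
    qed
    ultimately have "((\<lambda>k. coef (sh i x) k * (\<Prod>j\<in>UNIV. (z $ j) ^ k j)) has_sum
        mult_coord i (hfun x) z) (range (inc i))"
      by (simp add: has_sum_reindex[OF inj_inc] o_def)
    then show "((\<lambda>k. coef (sh i x) k * (\<Prod>j\<in>UNIV. (z $ j) ^ k j)) has_sum
        mult_coord i (hfun x) z) UNIV"
      by (rule has_sum_cong_neutral[THEN iffD1, rotated 3]) (auto simp: range_inc)
  qed
qed (simp add: mult_coord_def hfun_outside)

lemma elem_tensor_hfun: "elem_tensor (\<lambda>i. hfun (f i)) = hfun (tens f)"
proof (rule hfun_eqI)
  show "has_taylor (elem_tensor (\<lambda>i. hfun (f i))) (coef (tens f))"
    unfolding has_taylor_def
  proof
    fix z :: "complex ^ 'a" assume z: "z \<in> polydisc"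
    define t where "t i m = coef (f i) (\<lambda>_. m) * (z $ i) ^ m" for i m
    have vec: "vec (z $ i) \<in> (polydisc :: (complex ^ 1) set)" for i
      using z by (simp add: polydisc_def)
    have sum: "(\<lambda>k. norm (coef (f i) k * (\<Prod>j\<in>UNIV. (vec (z $ i) $ j) ^ k j))) summable_on UNIV" for i
      by (intro square_summable_mult square_summable_coef square_summable_monomials vec)
    have "(\<lambda>m. norm (t i m)) summable_on UNIV" for i
      using summable_on_reindex_bij_betw[OF bij_const_num1,
          of "\<lambda>k. norm (coef (f i) k * (\<Prod>j\<in>UNIV. (vec (z $ i) $ j) ^ k j))"] sum[of i]
      by (simp add: t_def)
    note t_sum = this
    have "(\<Sum>\<^sub>\<infinity>m. t i m) = hfun (f i) (vec (z $ i))" for i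
      using infsum_reindex_bij_betw[OF bij_const_num1,
          of "\<lambda>k. coef (f i) k * (\<Prod>j\<in>UNIV. (vec (z $ i) $ j) ^ k j)"]
      by (simp add: t_def hfun_def vec)
    then have "(\<Sum>\<^sub>\<infinity>k. \<Prod>i\<in>UNIV. t i (k i)) = elem_tensor (\<lambda>i. hfun (f i)) z"
      using infsum_prod[of t, OF t_sum] by (simp add: elem_tensor_def)
    moreover have "(\<lambda>k. \<Prod>i\<in>UNIV. t i (k i)) summable_on UNIV"
      by (rule abs_summable_summable[OF abs_summable_prod[OF t_sum]])
    ultimately have "((\<lambda>k. \<Prod>i\<in>UNIV. t i (k i)) has_sum elem_tensor (\<lambda>i. hfun (f i)) z) UNIV"
      by (metis has_sum_infsum)
    then show "((\<lambda>k. coef (tens f) k * (\<Prod>i\<in>UNIV. (z $ i) ^ k i)) has_sum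
        elem_tensor (\<lambda>i. hfun (f i)) z) UNIV"
      by (simp add: t_def coef_tens prod.distrib)
  qed
next
  \<comment> \<open>Outside the polydisc some coordinate lies outside the disc, and the factor
    belonging to it is zero by convention.\<close>
  fix z :: "complex ^ 'a" assume "z \<notin> polydisc"
  then obtain i where "vec (z $ i) \<notin> (polydisc :: (complex ^ 1) set)"
    by (auto simp: polydisc_def)
  then have "hfun (f i) (vec (z $ i)) = 0" by (rule hfun_outside)
  then show "elem_tensor (\<lambda>i. hfun (f i)) z = 0"
    unfolding elem_tensor_def by (meson UNIV_I finite prod_zero)
qed

text \<open>
  \<open>Metric_space\<close> demands symmetry for all functions, hence also where \<open>taylor\<close> is an arbitrary
  value because there is no Taylor expansion.
\<close>

lemma has_taylor_uminus: "has_taylor (- h) a \<longleftrightarrow> has_taylor h (\<lambda>k. - a k)"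
  by (simp add: has_taylor_def has_sum_uminus)

lemma hardy_norm_uminus: "hardy_norm (- h) = hardy_norm h"
proof (cases "\<exists>a. has_taylor h a")
  case True
  then obtain a where a: "has_taylor h a" by blast
  then have "has_taylor (- h) (\<lambda>k. - a k)" by (simp add: has_taylor_uminus)
  with a show ?thesis by (simp add: hardy_norm_def hardy_inner_def taylor_eqI)
next
  case False
  \<comment> \<open>Neither function has an expansion, so both descriptions use the same everywhere
    false predicate and denote the same value.\<close>
  then have "taylor (- h) = taylor h"
    unfolding taylor_def has_taylor_uminus by (intro arg_cong[of _ _ The]) auto
  then show ?thesis by (simp add: hardy_norm_def hardy_inner_def)
qed

lemma hardy_norm_nonneg: "0 \<le> hardy_norm h"
proof -
  have "0 \<le> Re (hardy_inner h h)"
  proof (cases "(\<lambda>k. taylor h k * cnj (taylor h k)) summable_on UNIV")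
    case True
    then have "Re (hardy_inner h h) = (\<Sum>\<^sub>\<infinity>k. Re (taylor h k * cnj (taylor h k)))"
      by (simp only: hardy_inner_def infsum_Re)
    then show ?thesis by (simp add: infsum_nonneg)
  next
    case False
    then show ?thesis by (simp add: hardy_inner_def infsum_not_exists)
  qed
  then show ?thesis by (simp add: hardy_norm_def)
qed

section \<open>Topology, adjoints and projections for functions\<close>

lemma hardy_dist: "hardy_norm (hfun x - hfun y) = dist x y"
  by (simp add: dist_norm flip: hfun.diff)

interpretation hardy: Metric_space hardy "\<lambda>f g. hardy_norm (f - g)"
proof
  fix f g h :: "complex ^ 'a \<Rightarrow> complex"
  show "0 \<le> hardy_norm (f - g)" by (rule hardy_norm_nonneg)
  show "hardy_norm (f - g) = hardy_norm (g - f)"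
    using hardy_norm_uminus[of "f - g"] by simp
  show "hardy_norm (f - g) = 0 \<longleftrightarrow> f = g" if fg: "f \<in> hardy" "g \<in> hardy"
  proof -
    obtain x y where "f = hfun x" "g = hfun y" using fg unfolding hardy_eq by blast
    then show ?thesis by (simp add: hardy_dist)
  qed
  show "hardy_norm (f - h) \<le> hardy_norm (f - g) + hardy_norm (g - h)"
    if "f \<in> hardy" "g \<in> hardy" "h \<in> hardy"
    using that by (auto simp: hardy_eq hardy_dist dist_triangle)
qed

text \<open>\<open>hfun\<close> is an isometry from the coefficient space onto \<open>hardy\<close>,
  so closures correspond.\<close>

lemma closure_of_hfun: "hardy_topology closure_of (hfun ` S) = hfun ` closure S"
  unfolding hardy_topology_def hardy.metric_closure_of hardy.in_mball
  by (auto simp: hardy_eq hardy_dist closure_approachable image_iff dist_commute)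

lemma closedin_hfun: "closedin hardy_topology (hfun ` S) \<longleftrightarrow> closed S"
proof -
  have "hfun ` S \<subseteq> topspace hardy_topology"
    unfolding hardy_topology_def hardy.topspace_mtopology by (auto simp: hardy_eq)
  then have "closedin hardy_topology (hfun ` S) \<longleftrightarrow> hfun ` closure S = hfun ` S"
    using closure_of_eq[of hardy_topology "hfun ` S"] closure_of_hfun by metis
  also have "\<dots> \<longleftrightarrow> closed S"
    by (simp add: closure_eq)
  finally show ?thesis .
qed

lemma subspace_hfun: "cfun.subspace (hfun ` S) \<longleftrightarrow> ell2.subspace S"
proof
  assume "cfun.subspace (hfun ` S)"
  then have "ell2.subspace (hfun -` hfun ` S)" by (rule hfun.subspace_vimage)
  moreover have "hfun -` hfun ` S = S" by auto
  ultimately show "ell2.subspace S" by simp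
qed (rule hfun.subspace_image)

text \<open>The premise makes \<open>w\<close> a candidate for the adjoint value; uniqueness follows
  by testing two candidates against their difference.\<close>

lemma adjoint_on_hfun:
  assumes S: "closed_csubspace S" and "w \<in> S"
    and adj: "\<And>x. x \<in> S \<Longrightarrow> hardy_inner (T (hfun x)) (hfun y) = cinner x w"
  shows "adjoint_on (hfun ` S) T (hfun y) = hfun w"
  unfolding adjoint_on_def
proof (rule the_equality)
  show "hfun w \<in> hfun ` S \<and> (\<forall>f\<in>hfun ` S. hardy_inner (T f) (hfun y) = hardy_inner f (hfun w))"
    using assms by auto
  fix h
  assume h: "h \<in> hfun ` S \<and> (\<forall>f\<in>hfun ` S. hardy_inner (T f) (hfun y) = hardy_inner f h)"
  then obtain v where v: "v \<in> S" "h = hfun v" by blast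
  with h adj have "cinner x w = cinner x v" if "x \<in> S" for x
    using that by auto
  from this[of "w - v"] have "cinner (w - v) (w - v) = 0"
    using closed_csubspaceD(4)[OF S] assms(2) v(1) by (simp add: cinner_diff_right)
  then show "h = hfun w" using v(2) by (simp only: cinner_eq_zero) simp
qed

lemma proj_on_hfun:
  assumes S: "closed_csubspace S"
  shows "proj_on (hfun ` S) (hfun x) = hfun (eproj S x)"
  unfolding proj_on_def
proof (rule the_equality)
  show "hfun (eproj S x) \<in> hfun ` S \<and> (\<forall>h\<in>hfun ` S. hardy_inner (hfun x - hfun (eproj S x)) h = 0)"
    using eproj_works[OF S] by (auto simp flip: hfun.diff)
  fix g assume g: "g \<in> hfun ` S \<and> (\<forall>h\<in>hfun ` S. hardy_inner (hfun x - g) h = 0)"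
  then obtain p where p: "p \<in> S" "g = hfun p" by blast
  with g have "\<And>h. h \<in> S \<Longrightarrow> cinner (x - p) h = 0" by (auto simp flip: hfun.diff)
  with p show "g = hfun (eproj S x)"
    using eproj_eqI[OF S, of p x] by (simp add: cinner_diff_left)
qed

lemma adjoint_on_hardy: "adjoint_on hardy (mult_coord i) (hfun x) = hfun (bs i x)"
  unfolding hardy_eq
  by (rule adjoint_on_hfun)
     (auto simp: closed_csubspace_def mult_coord_hfun cinner_sh_left)

lemma quotient_module_hfun: "quotient_module (hfun ` S) \<longleftrightarrow> backward_invariant S"
proof -
  have "hfun ` S \<subseteq> hardy" by (auto simp: hardy_eq)
  then show ?thesis
    unfolding quotient_module_def backward_invariant_def closed_csubspace_def
    by (auto simp: subspace_hfun closedin_hfun adjoint_on_hardy inj_image_mem_iff inj_def)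
qed

lemma quotient_module_imageE:
  assumes "quotient_module Q"
  obtains S where "Q = hfun ` S"
  using assms unfolding quotient_module_def hardy_eq by (meson subset_imageE)

context backward_invariant
begin

lemma compression_hfun: "compression (hfun ` S) i (hfun x) = hfun (cshift i x)"
  by (simp add: compression_def mult_coord_hfun proj_on_hfun[OF closed] cshift_def)

lemma adjoint_compression:
  "x \<in> S \<Longrightarrow> adjoint_on (hfun ` S) (compression (hfun ` S) i) (hfun x) = hfun (bs i x)"
  by (rule adjoint_on_hfun[OF closed]) (auto simp: compression_hfun bs_in cinner_cshift)

text \<open>Taking adjoints on \<open>S\<close> exchanges the roles of \<open>i\<close> and
  \<open>j\<close>. This carries the relation from pairs \<open>i < j\<close>, as in
  \<open>doubly_commuting\<close>, to all distinct pairs.\<close>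

lemma cshift_bs_swap:
  assumes ij: "\<And>x. x \<in> S \<Longrightarrow> cshift j (bs i x) = bs i (cshift j x)" and x: "x \<in> S"
  shows "cshift i (bs j x) = bs j (cshift i x)"
proof -
  have adj: "cinner y (cshift k z) = cinner (bs k y) z" if "y \<in> S" for k y z
    using cinner_cshift[OF that] by (metis cnj_cinner)
  have eq: "cinner (cshift i (bs j x)) y = cinner (bs j (cshift i x)) y" if y: "y \<in> S" for y
  proof -
    have "cinner (cshift i (bs j x)) y = cinner x (cshift j (bs i y))"
      using x y by (simp add: cinner_cshift adj)
    also have "\<dots> = cinner x (bs i (cshift j y))" using ij y by simp
    also have "\<dots> = cinner (bs j (cshift i x)) y"
      using adj[of "cshift i x" j y] cinner_cshift[of "cshift j y" i x] by simp
    finally show ?thesis .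
  qed
  \<comment> \<open>Both vectors lie in \<open>S\<close> and have equal inner products with
    \<open>S\<close>; the uniqueness in \<open>eproj_eqI\<close> identifies them.\<close>
  have "eproj S (cshift i (bs j x)) = bs j (cshift i x)"
    by (rule eproj_eqI[OF closed]) (auto intro: bs_in simp: eq)
  then show ?thesis by (simp add: eproj_id[OF closed])
qed

end

section \<open>Double commutation and tensor products for functions\<close>

lemma doubly_commuting_hfun:
  fixes S :: "('n::{finite,linorder} \<Rightarrow> nat) ell2 set"
  assumes "backward_invariant S"
  shows "doubly_commuting (hfun ` S) \<longleftrightarrow>
    (\<forall>i j. i \<noteq> j \<longrightarrow> (\<forall>x\<in>S. eproj S (sh i (bs j x)) = bs j (eproj S (sh i x))))"
proof -
  interpret backward_invariant S by fact
  have "doubly_commuting (hfun ` S) \<longleftrightarrow>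
      (\<forall>i j. i < j \<longrightarrow> (\<forall>x\<in>S. cshift i (bs j x) = bs j (cshift i x)))"
    by (simp add: doubly_commuting_def adjoint_compression compression_hfun)
  also have "\<dots> \<longleftrightarrow> (\<forall>i j. i \<noteq> j \<longrightarrow> (\<forall>x\<in>S. cshift i (bs j x) = bs j (cshift i x)))"
  proof (intro iffI allI impI ballI)
    fix i j :: 'n and x
    assume *: "\<forall>i j. i < j \<longrightarrow> (\<forall>x\<in>S. cshift i (bs j x) = bs j (cshift i x))" and "i \<noteq> j" "x \<in> S"
    show "cshift i (bs j x) = bs j (cshift i x)"
    proof (cases "i < j")
      case True
      with * \<open>x \<in> S\<close> show ?thesis by blast
    next
      case False
      with \<open>i \<noteq> j\<close> have "j < i" by simp
      with * have "cshift j (bs i y) = bs i (cshift j y)" if "y \<in> S" for y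
        using that by blast
      then show ?thesis using \<open>x \<in> S\<close> by (rule cshift_bs_swap)
    qed
  qed auto
  finally show ?thesis by (simp add: cshift_def)
qed

lemma hilbert_tensor_hfun:
  "hilbert_tensor (\<lambda>i. hfun ` R i) = hfun ` closure (ell2.span {tens f | f. \<forall>i. f i \<in> R i})"
proof -
  have "{elem_tensor f | f. \<forall>i. f i \<in> hfun ` R i} = hfun ` {tens f | f. \<forall>i. f i \<in> R i}"
  proof (intro equalityI subsetI)
    fix t assume "t \<in> {elem_tensor f | f. \<forall>i. f i \<in> hfun ` R i}"
    then obtain f where f: "t = elem_tensor f" "\<forall>i. \<exists>x. x \<in> R i \<and> f i = hfun x" by blast
    then obtain g where "\<forall>i. g i \<in> R i \<and> f i = hfun (g i)" by metis
    then have "t = elem_tensor (\<lambda>i. hfun (g i))" "\<forall>i. g i \<in> R i"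
      using f(1) by (auto intro!: arg_cong[of _ _ elem_tensor])
    then show "t \<in> hfun ` {tens f | f. \<forall>i. f i \<in> R i}" by (auto simp: elem_tensor_hfun)
  next
    fix t assume "t \<in> hfun ` {tens f | f. \<forall>i. f i \<in> R i}"
    then obtain g where "t = elem_tensor (\<lambda>i. hfun (g i))" "\<forall>i. g i \<in> R i"
      by (auto simp: elem_tensor_hfun)
    then show "t \<in> {elem_tensor f | f. \<forall>i. f i \<in> hfun ` R i}" by blast
  qed
  then show ?thesis
    by (simp add: hilbert_tensor_def hfun.span_image closure_of_hfun)
qed

theorem theorem4p4:
  fixes Q :: "(complex ^ 'n::{finite,linorder} \<Rightarrow> complex) set"
  assumes "quotient_module Q"
  shows "doubly_commuting Q \<longleftrightarrow>
    (\<exists>R :: 'n \<Rightarrow> (complex ^ 1 \<Rightarrow> complex) set.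
       (\<forall>i. quotient_module (R i)) \<and> Q = hilbert_tensor R)"
proof -
  obtain S where Q: "Q = hfun ` S" using assms by (rule quotient_module_imageE)
  with assms interpret backward_invariant S by (simp add: quotient_module_hfun)
  have inv: "backward_invariant S" by unfold_locales
  show ?thesis
  proof
    assume "doubly_commuting Q"
    then have dc: "eproj S (sh i (bs j x)) = bs j (eproj S (sh i x))" if "i \<noteq> j" "x \<in> S" for i j x
      using that by (simp add: Q doubly_commuting_hfun[OF inv])
    have "\<exists>R. (\<forall>i. backward_invariant (R i)) \<and> S = closure (ell2.span {tens f | f. \<forall>i. f i \<in> R i})"
      by (rule tensor_decomposition_exists[OF dc])
    then obtain R where "\<And>i. backward_invariant (R i)"
        "S = closure (ell2.span {tens f | f. \<forall>i. f i \<in> R i})" by blast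
    then show "\<exists>R. (\<forall>i. quotient_module (R i)) \<and> Q = hilbert_tensor R"
      by (intro exI[of _ "\<lambda>i. hfun ` R i"])
         (simp add: quotient_module_hfun hilbert_tensor_hfun Q)
  next
    assume "\<exists>R :: 'n \<Rightarrow> (complex ^ 1 \<Rightarrow> complex) set.
      (\<forall>i. quotient_module (R i)) \<and> Q = hilbert_tensor R"
    then obtain R :: "'n \<Rightarrow> (complex ^ 1 \<Rightarrow> complex) set"
      where R: "\<And>i. quotient_module (R i)" "Q = hilbert_tensor R" by blast
    \<comment> \<open>Each given module is the image of a coefficient subspace; injectivity of
      \<open>hfun\<close> then carries the equation for \<open>Q\<close> to coefficients.\<close>
    have "\<forall>i. \<exists>S. R i = hfun ` S" using R(1) quotient_module_imageE by metis
    then obtain T where T: "\<And>i. R i = hfun ` T i" by metis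
    have "hfun ` S = hfun ` closure (ell2.span {tens f | f. \<forall>i. f i \<in> T i})"
      using R(2) unfolding Q T[abs_def] hilbert_tensor_hfun[symmetric] by (simp add: T)
    then have S: "S = closure (ell2.span {tens f | f. \<forall>i. f i \<in> T i})"
      by simp
    have "backward_invariant (T i)" for i
      using R(1) by (simp add: T quotient_module_hfun)
    then have T_closed: "closed_csubspace (T i)" and T_bs: "f \<in> T i \<Longrightarrow> bs 1 f \<in> T i" for i f
      by (simp_all add: backward_invariant_def)
    show "doubly_commuting Q"
      unfolding Q doubly_commuting_hfun[OF inv]
      by (intro allI impI ballI) (rule tensor_doubly_commuting[OF T_closed T_bs S])
  qed
qed

end
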